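(* For every $s\geq 1$, Subset Vertex Cover can be solved in polynomial time for instances $(G,T,k)$ for which $G[T]$ is $sP_2$-free.
   Context: Subset Vertex Cover is the problem: given a graph $G=(V,E)$, a subset $T\subseteq V$ and a positive integer $k$, decide whether $G$ has a $T$-vertex cover of size at most $k$, where a $T$-vertex cover is a set $S\subseteq V$ containing at least one end-vertex of every edge incident to a vertex of $T$. $sP_2$ is the disjoint union of $s$ edges; $H$-free means no induced subgraph isomorphic to $H$. *)

theory Defs
  imports
    "HOL-Computational_Algebra.Polynomial"
    "Graph_Theory.Pair_Digraph"
    "Graph_Theory.Digraph_Isomorphism"
begin

section \<open>Machine model\<close>

text \<open>
  Random access machine with unit-cost addition and truncated subtraction, presented as a
  while language. The memory consists of arrays of natural numbers; a program can address only
  the finitely many arrays whose numbers occur in its text, while the index into an array is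
  computed at run time.

  There is deliberately no multiplication or shift: with addition and subtraction only, all
  numbers (contents and addresses) arising in \<open>t\<close> steps have at most \<open>t\<close> bits more than the
  largest number present initially or in the program text. Hence the
  machine is polynomially equivalent to a Turing machine in spite of the uniform cost measure.
\<close>

datatype expr =
    Const nat
  | Load nat expr  \<comment> \<open>array number (static), index (dynamic)\<close>
  | Add expr expr
  | Sub expr expr

datatype prog =
    Skip
  | Store nat expr expr  \<comment> \<open>array number, index, new value\<close>
  | Seq prog prog
  | IfNZ expr prog prog
  | WhileNZ expr prog

type_synonym memory = "nat \<Rightarrow> nat \<Rightarrow> nat"

primrec expr_val :: "expr \<Rightarrow> memory \<Rightarrow> nat" where
  "expr_val (Const n) m = n"
| "expr_val (Load a e) m = m a (expr_val e m)"
| "expr_val (Add e f) m = expr_val e m + expr_val f m"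
| "expr_val (Sub e f) m = expr_val e m - expr_val f m"

primrec expr_time :: "expr \<Rightarrow> nat" where
  "expr_time (Const n) = 1"
| "expr_time (Load a e) = 1 + expr_time e"
| "expr_time (Add e f) = 1 + expr_time e + expr_time f"
| "expr_time (Sub e f) = 1 + expr_time e + expr_time f"

text \<open>\<open>exec c m t m'\<close>: started in \<open>m\<close>, the program \<open>c\<close> halts after exactly \<open>t\<close> steps in \<open>m'\<close>.\<close>

inductive exec :: "prog \<Rightarrow> memory \<Rightarrow> nat \<Rightarrow> memory \<Rightarrow> bool" where
  Skip: "exec Skip m 1 m"
| Store: "exec (Store a e f) m (1 + expr_time e + expr_time f)
            (m(a := (m a)(expr_val e m := expr_val f m)))"
| Seq: "exec c m t m' \<Longrightarrow> exec d m' t' m'' \<Longrightarrow> exec (Seq c d) m (t + t') m''"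
| If_true: "expr_val e m \<noteq> 0 \<Longrightarrow> exec c m t m' \<Longrightarrow>
            exec (IfNZ e c d) m (1 + expr_time e + t) m'"
| If_false: "expr_val e m = 0 \<Longrightarrow> exec d m t m' \<Longrightarrow>
            exec (IfNZ e c d) m (1 + expr_time e + t) m'"
| While_false: "expr_val e m = 0 \<Longrightarrow> exec (WhileNZ e c) m (1 + expr_time e) m"
| While_true: "expr_val e m \<noteq> 0 \<Longrightarrow> exec c m t m' \<Longrightarrow> exec (WhileNZ e c) m' t' m'' \<Longrightarrow>
            exec (WhileNZ e c) m (1 + expr_time e + t + t') m''"

inductive_cases exec_SkipE: "exec Skip m t m'"
inductive_cases exec_StoreE: "exec (Store a e f) m t m'"
inductive_cases exec_SeqE: "exec (Seq c d) m t m'"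
inductive_cases exec_IfE: "exec (IfNZ e c d) m t m'"
inductive_cases exec_WhileE: "exec (WhileNZ e c) m t m'"

lemma exec_deterministic:
  "exec c m t m' \<Longrightarrow> exec c m u m'' \<Longrightarrow> t = u \<and> m' = m''"
proof (induction arbitrary: u m'' rule: exec.induct)
  case (Skip m)
  then show ?case by (auto elim: exec_SkipE)
next
  case (Store a e f m)
  then show ?case by (auto elim: exec_StoreE)
next
  case (Seq c m t m' d t' m2)
  from Seq.prems obtain t1 m1 t2 where r: "u = t1 + t2" "exec c m t1 m1" "exec d m1 t2 m''"
    by (rule exec_SeqE)
  from Seq.IH(1)[OF r(2)] Seq.IH(2)[of t2 m''] r(1,3) show ?case by simp
next
  case (If_true e m c t m' d)
  from If_true.prems
  obtain t1 where r: "u = Suc (expr_time e + t1)" "exec c m t1 m''"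
    by (rule exec_IfE) (use If_true.hyps(1) in simp_all)
  from If_true.IH[OF r(2)] r(1) show ?case by simp
next
  case (If_false e m d t m' c)
  from If_false.prems
  obtain t1 where r: "u = Suc (expr_time e + t1)" "exec d m t1 m''"
    by (rule exec_IfE) (use If_false.hyps(1) in simp_all)
  from If_false.IH[OF r(2)] r(1) show ?case by simp
next
  case (While_false e m c)
  from While_false.prems show ?case
    by (rule exec_WhileE) (use While_false.hyps in simp_all)
next
  case (While_true e m c t m' t' m2)
  from While_true.prems obtain t1 m1 t2
    where r: "u = Suc (expr_time e + t1 + t2)" "exec c m t1 m1" "exec (WhileNZ e c) m1 t2 m''"
    by (rule exec_WhileE) (use While_true.hyps(1) in simp_all)
  from While_true.IH(1)[OF r(2)] While_true.IH(2)[of t2 m''] r(1,3) show ?case by simp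
qed

text \<open>
  Input: the bits of the word in array 0, its length in cell 0 of array 1.
  Output: cell 0 of array 2 (nonzero means ``yes'').
\<close>

definition init_memory :: "bool list \<Rightarrow> memory" where
  "init_memory w = (\<lambda>a i.
     if a = 0 \<and> i < length w \<and> w ! i then 1
     else if a = 1 \<and> i = 0 then length w
     else 0)"

definition accepting :: "memory \<Rightarrow> bool" where
  "accepting m \<longleftrightarrow> m 2 0 \<noteq> 0"

text \<open>
  A decision problem on instances of type \<open>'i\<close>: \<open>enc x w\<close> says that the binary word \<open>w\<close> is an
  encoding of \<open>x\<close>, and \<open>Q x\<close> that the answer on \<open>x\<close> is ``yes''. One program and one polynomial
  must serve all instances in \<open>D\<close> (and all their encodings); nothing is required elsewhere.
\<close>

definition poly_time_solvable_on ::
  "('i \<Rightarrow> bool list \<Rightarrow> bool) \<Rightarrow> ('i \<Rightarrow> bool) \<Rightarrow> 'i set \<Rightarrow> bool" where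
  "poly_time_solvable_on enc Q D \<longleftrightarrow>
     (\<exists>(c :: prog) (p :: nat poly). \<forall>x\<in>D. \<forall>w. enc x w \<longrightarrow>
        (\<exists>t m. exec c (init_memory w) t m \<and> t \<le> poly p (length w) \<and>
               (accepting m \<longleftrightarrow> Q x)))"

section \<open>Graphs\<close>

text \<open>
  A finite simple undirected graph is a \<open>pair_graph\<close>: an edge \<open>{u, v}\<close> is represented by the
  two arcs \<open>(u, v)\<close> and \<open>(v, u)\<close>.
\<close>

definition H_free :: "('c, 'd) pre_digraph \<Rightarrow> ('a, 'b) pre_digraph \<Rightarrow> bool" where
  "H_free H G \<longleftrightarrow> \<not> (\<exists>F. induced_subgraph F G \<and> digraph_iso F H)"

definition sP2 :: "nat \<Rightarrow> (nat \<times> bool) pair_pre_digraph" where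
  "sP2 s = \<lparr> pverts = {..<s} \<times> UNIV, parcs = {((i, b), (i, \<not> b)) |i b. i < s} \<rparr>"

definition T_vertex_cover :: "'a pair_pre_digraph \<Rightarrow> 'a set \<Rightarrow> 'a set \<Rightarrow> bool" where
  "T_vertex_cover G T S \<longleftrightarrow>
     S \<subseteq> pverts G \<and> (\<forall>(u, v)\<in>parcs G. u \<in> T \<or> v \<in> T \<longrightarrow> u \<in> S \<or> v \<in> S)"

section \<open>Subset Vertex Cover\<close>

type_synonym svc_instance = "nat pair_pre_digraph \<times> nat set \<times> nat"

definition svc_instances :: "svc_instance set" where
  "svc_instances = {(G, T, k). pair_graph G \<and> T \<subseteq> pverts G \<and> k > 0}"

definition svc_yes :: "svc_instance \<Rightarrow> bool" where
  "svc_yes = (\<lambda>(G, T, k). \<exists>S. T_vertex_cover G T S \<and> card S \<le> k)"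

text \<open>Binary representation, least significant bit first.\<close>

fun nat_bits :: "nat \<Rightarrow> bool list" where
  "nat_bits n = (if n = 0 then [] else odd n # nat_bits (n div 2))"

declare nat_bits.simps [simp del]

text \<open>
  With respect to an enumeration \<open>vs\<close> of the \<open>n\<close> vertices: \<open>n\<close> in unary, the characteristic
  vector of \<open>T\<close>, the adjacency matrix row by row, and \<open>k\<close> in binary.
\<close>

definition svc_word :: "nat list \<Rightarrow> svc_instance \<Rightarrow> bool list" where
  "svc_word vs = (\<lambda>(G, T, k).
     replicate (length vs) True @ [False] @
     map (\<lambda>v. v \<in> T) vs @
     concat (map (\<lambda>u. map (\<lambda>v. (u, v) \<in> parcs G) vs) vs) @
     nat_bits k)"

definition svc_encodes :: "svc_instance \<Rightarrow> bool list \<Rightarrow> bool" where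
  "svc_encodes = (\<lambda>(G, T, k) w.
     \<exists>vs. distinct vs \<and> set vs = pverts G \<and> w = svc_word vs (G, T, k))"

end

theory Submission
  imports Defs
begin

text \<open>
  The complement in \<open>T\<close> of a \<open>T\<close>-vertex cover is independent, hence contained in a maximal
  independent set \<open>I\<close> of \<open>G[T]\<close>. Conversely, once \<open>I\<close> is fixed, a cheapest \<open>T\<close>-vertex cover
  containing \<open>T - I\<close> is obtained by adding a minimum vertex cover of the bipartite graph between \<open>I\<close>
  and \<open>V - T\<close>, whose size is that of a maximum matching. Each maximal independent set
  of an \<open>sP\<^sub>2\<close>-free graph is the output of a greedy procedure with at most \<open>s - 1\<close> pairs of
  vertices as advice, so that there are only polynomially many candidates. The
  matching is found by an auction; all loops are bounded for-loops, which makes the running time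
  a polynomial that can be read off the program.
\<close>

section \<open>Bounded loops\<close>

text \<open>A bound on the number of maximal independent sets is not yet a way to list them.
  Encoding each by a bounded number of pairs turns the listing into nested loops of fixed depth
  \<open>2 * (s - 1)\<close>, which is why the exponent of the polynomial depends on
  \<open>s\<close>. Some advice yields sets that are not maximal, which is harmless: every output
  \<open>I\<close> is independent, and the cheapest cover containing \<open>T - I\<close> is a
  genuine \<open>T\<close>-vertex cover. Freeness of \<open>G[T]\<close> enters in the other
  direction, to ensure that some advice yields a set containing the complement in \<open>T\<close>
  of an optimal cover.

  The auction takes the place of augmenting paths because it fits the same kind of loop: each
  effective round raises the sum of the prices by one, and this sum never exceeds
  \<open>n * (n + 1)\<close>, so a fixed number of identical rounds suffices. The word is longer
  than that, as it contains the adjacency matrix, and its length can serve as the loop bound. The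
  final prices also exhibit the dual cover directly, so optimality needs no separate duality
  theorem.\<close>

datatype lprog =
    LSkip
  | LStore nat expr expr
  | LSeq lprog lprog  (infixr \<open>;;\<close> 60)
  | LIf expr lprog lprog
  | LFor nat nat lprog
      \<comment> \<open>\<open>LFor v b c\<close>: the counter is cell 0 of array \<open>v\<close>, the bound is cell 0 of array \<open>b\<close>\<close>

abbreviation set_cell :: "memory \<Rightarrow> nat \<Rightarrow> nat \<Rightarrow> nat \<Rightarrow> memory" where
  "set_cell m a i x \<equiv> m(a := (m a)(i := x))"

text \<open>The number of rounds is fixed on entry, whereas the compiled loop compares counter and
  bound anew before each round. The two agree when the body writes neither array;
  \<open>counters_ok\<close> and disjointness of \<open>bounds\<close> and \<open>writes\<close>
  express this.\<close>

primrec sem :: "lprog \<Rightarrow> memory \<Rightarrow> memory" where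
  "sem LSkip m = m"
| "sem (LStore a e f) m = set_cell m a (expr_val e m) (expr_val f m)"
| "sem (c ;; d) m = sem d (sem c m)"
| "sem (LIf e c d) m = (if expr_val e m \<noteq> 0 then sem c m else sem d m)"
| "sem (LFor v b c) m =
     ((\<lambda>x. set_cell (sem c x) v 0 (Suc (sem c x v 0))) ^^ (m b 0)) (set_cell m v 0 0)"

primrec compile :: "lprog \<Rightarrow> prog" where
  "compile LSkip = Skip"
| "compile (LStore a e f) = Store a e f"
| "compile (c ;; d) = Seq (compile c) (compile d)"
| "compile (LIf e c d) = IfNZ e (compile c) (compile d)"
| "compile (LFor v b c) =
     Seq (Store v (Const 0) (Const 0))
       (WhileNZ (Sub (Load b (Const 0)) (Load v (Const 0)))
         (Seq (compile c) (Store v (Const 0) (Add (Load v (Const 0)) (Const 1)))))"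

primrec writes :: "lprog \<Rightarrow> nat set" where
  "writes LSkip = {}"
| "writes (LStore a e f) = {a}"
| "writes (c ;; d) = writes c \<union> writes d"
| "writes (LIf e c d) = writes c \<union> writes d"
| "writes (LFor v b c) = insert v (writes c)"

primrec bounds :: "lprog \<Rightarrow> nat set" where
  "bounds LSkip = {}"
| "bounds (LStore a e f) = {}"
| "bounds (c ;; d) = bounds c \<union> bounds d"
| "bounds (LIf e c d) = bounds c \<union> bounds d"
| "bounds (LFor v b c) = insert b (bounds c)"

primrec counters_ok :: "lprog \<Rightarrow> bool" where
  "counters_ok LSkip = True"
| "counters_ok (LStore a e f) = True"
| "counters_ok (c ;; d) = (counters_ok c \<and> counters_ok d)"
| "counters_ok (LIf e c d) = (counters_ok c \<and> counters_ok d)"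
| "counters_ok (LFor v b c) = (v \<notin> writes c \<and> counters_ok c)"

text \<open>A polynomial in one common bound for all loop bounds. Both branches of a conditional are
  added, for want of a maximum of polynomials. A loop pays 3 for resetting the counter and 6 for the
  final test; each round pays 6 for the test and 6 for the increment.\<close>

primrec cost :: "lprog \<Rightarrow> nat poly" where
  "cost LSkip = [:1:]"
| "cost (LStore a e f) = [:1 + expr_time e + expr_time f:]"
| "cost (c ;; d) = cost c + cost d"
| "cost (LIf e c d) = [:1 + expr_time e:] + cost c + cost d"
| "cost (LFor v b c) = [:9:] + [:0, 1:] * ([:12:] + cost c)"

lemma sem_frame: "a \<notin> writes c \<Longrightarrow> sem c m a = m a"
proof (induction c arbitrary: m)
  case (LFor v b c)
  have "((\<lambda>x. set_cell (sem c x) v 0 (Suc (sem c x v 0))) ^^ k) (set_cell m v 0 0) a = m a" for k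
    using LFor by (induction k) auto
  then show ?case by simp
qed auto

text \<open>The step also receives what is common to all loops: the round, the counter, and that
  unwritten arrays are as on entry. An invariant then has to mention only what the body
  changes.\<close>

lemma sem_LFor_induct:
  assumes "counters_ok (LFor v b c)"
    and base: "P 0 (set_cell m v 0 0)"
    and step: "\<And>i x. i < m b 0 \<Longrightarrow> (\<And>a. a \<notin> insert v (writes c) \<Longrightarrow> x a = m a) \<Longrightarrow> x v 0 = i \<Longrightarrow>
                  P i x \<Longrightarrow> P (Suc i) (set_cell (sem c x) v 0 (Suc i))"
  shows "P (m b 0) (sem (LFor v b c) m)"
proof -
  have v: "v \<notin> writes c" using assms(1) by simp
  define g where "g = (\<lambda>x. set_cell (sem c x) v 0 (Suc (sem c x v 0)))"
  define m0 where "m0 = set_cell m v 0 0"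
  have m0: "P 0 m0" "m0 v 0 = 0" "\<And>a. a \<noteq> v \<Longrightarrow> m0 a = m a"
    using base by (simp_all add: m0_def)
  have "k \<le> m b 0 \<Longrightarrow> P k ((g ^^ k) m0) \<and> (g ^^ k) m0 v 0 = k \<and>
     (\<forall>a. a \<notin> insert v (writes c) \<longrightarrow> (g ^^ k) m0 a = m a)" for k
  proof (induction k)
    case 0
    then show ?case using m0 by simp
  next
    case (Suc k)
    define x where "x = (g ^^ k) m0"
    have x: "P k x" "x v 0 = k" "\<And>a. a \<notin> insert v (writes c) \<Longrightarrow> x a = m a"
      using Suc x_def by auto
    have "(g ^^ Suc k) m0 = set_cell (sem c x) v 0 (Suc k)"
      using x(2) sem_frame[OF v, of x] by (simp add: g_def x_def)
    moreover have "P (Suc k) (set_cell (sem c x) v 0 (Suc k))"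
      using step[of k x] x Suc.prems by auto
    moreover have "set_cell (sem c x) v 0 (Suc k) a = m a" if "a \<notin> insert v (writes c)" for a
      using x(3) that by (auto simp: sem_frame)
    ultimately show ?case by (metis fun_upd_same)
  qed
  then show ?thesis by (simp add: g_def m0_def)
qed

text \<open>Induction on the number \<open>k\<close> of rounds left. \<open>C\<close> stands for the
  bounds of loops nested in the body: the estimate \<open>K\<close> must survive every change that
  earlier rounds make to other arrays.\<close>

lemma compile_LFor_exec:
  assumes v: "v \<notin> writes c" and b: "b \<noteq> v" "b \<notin> writes c" and C: "C \<subseteq> - insert v (writes c)"
    and body: "\<And>x. (\<And>a. a \<in> C \<Longrightarrow> x a = m a) \<Longrightarrow> \<exists>t\<le>K. exec (compile c) x t (sem c x)"
    and x: "\<And>a. a \<in> C \<Longrightarrow> x a = m a" "x b = m b" "x v 0 + k = m b 0"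
  shows "\<exists>t \<le> 6 + k * (12 + K).
    exec (WhileNZ (Sub (Load b (Const 0)) (Load v (Const 0)))
         (Seq (compile c) (Store v (Const 0) (Add (Load v (Const 0)) (Const 1))))) x t
      (((\<lambda>x. set_cell (sem c x) v 0 (Suc (sem c x v 0))) ^^ k) x)"
  using x
proof (induction k arbitrary: x)
  case 0
  show ?case
    using 0 exec.While_false[of "Sub (Load b (Const 0)) (Load v (Const 0))" x]
    by (intro exI[of _ 6]) (simp add: eval_nat_numeral)
next
  case (Suc k)
  define y where "y = set_cell (sem c x) v 0 (Suc (sem c x v 0))"
  obtain t where t: "t \<le> K" "exec (compile c) x t (sem c x)"
    using body[of x] Suc.prems(1) by auto
  have "exec (Store v (Const 0) (Add (Load v (Const 0)) (Const 1))) (sem c x) 6 y"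
    using exec.Store[of v "Const 0" "Add (Load v (Const 0)) (Const 1)" "sem c x"]
    by (simp add: y_def eval_nat_numeral)
  with t(2) have s: "exec (Seq (compile c) (Store v (Const 0) (Add (Load v (Const 0)) (Const 1)))) x (t + 6) y"
    by (rule exec.Seq)
  have fr: "\<And>a. a \<in> C \<Longrightarrow> y a = m a" "y b = m b" "y v 0 + k = m b 0"
    using Suc.prems b C sem_frame[of _ c x] v by (auto simp: y_def)
  from Suc.IH[OF fr] obtain u where u: "u \<le> 6 + k * (12 + K)"
    "exec (WhileNZ (Sub (Load b (Const 0)) (Load v (Const 0)))
         (Seq (compile c) (Store v (Const 0) (Add (Load v (Const 0)) (Const 1))))) y u
      (((\<lambda>x. set_cell (sem c x) v 0 (Suc (sem c x v 0))) ^^ k) y)" by blast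
  have nz: "expr_val (Sub (Load b (Const 0)) (Load v (Const 0))) x \<noteq> 0"
    using Suc.prems by simp
  have eq: "((\<lambda>x. set_cell (sem c x) v 0 (Suc (sem c x v 0))) ^^ Suc k) x =
      ((\<lambda>x. set_cell (sem c x) v 0 (Suc (sem c x v 0))) ^^ k) y"
    by (simp only: funpow_Suc_right o_apply y_def)
  have "1 + expr_time (Sub (Load b (Const 0)) (Load v (Const 0))) + (t + 6) + u \<le> 6 + Suc k * (12 + K)"
    using t u by simp
  then show ?case
    unfolding eq using exec.While_true[OF nz s u(2)] by blast
qed

text \<open>Arrays used as bounds are never written, so nested loops keep their initial bounds and
  one \<open>N\<close> serves throughout.\<close>

lemma compile_exec:
  assumes "counters_ok c" "bounds c \<inter> writes c = {}" "\<forall>b\<in>bounds c. m b 0 \<le> N"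
  shows "\<exists>t \<le> poly (cost c) N. exec (compile c) m t (sem c m)"
  using assms
proof (induction c arbitrary: m)
  case LSkip
  then show ?case using exec.Skip by auto
next
  case (LStore a e f)
  have "exec (compile (LStore a e f)) m (1 + expr_time e + expr_time f) (sem (LStore a e f) m)"
    using exec.Store[of a e f m] by simp
  moreover have "1 + expr_time e + expr_time f \<le> poly (cost (LStore a e f)) N" by simp
  ultimately show ?case by blast
next
  case (LSeq c d)
  have *: "sem c m b = m b" if "b \<in> bounds d" for b
    using LSeq.prems that by (intro sem_frame) auto
  obtain t where t: "t \<le> poly (cost c) N" "exec (compile c) m t (sem c m)"
    using LSeq.IH(1)[of m] LSeq.prems by auto
  obtain u where u: "u \<le> poly (cost d) N" "exec (compile d) (sem c m) u (sem d (sem c m))"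
    using LSeq.IH(2)[of "sem c m"] LSeq.prems * by auto
  show ?case using exec.Seq[OF t(2) u(2)] t(1) u(1) by (auto intro!: exI[of _ "t + u"])
next
  case (LIf e c d)
  show ?case
  proof (cases "expr_val e m = 0")
    case True
    obtain t where "t \<le> poly (cost d) N" "exec (compile d) m t (sem d m)"
      using LIf.IH(2)[of m] LIf.prems by auto
    then show ?thesis using If_false[OF True, of "compile d"] True
      by (intro exI[of _ "1 + expr_time e + t"]) simp
  next
    case False
    obtain t where "t \<le> poly (cost c) N" "exec (compile c) m t (sem c m)"
      using LIf.IH(1)[of m] LIf.prems by auto
    then show ?thesis using If_true[OF False, of "compile c"] False
      by (intro exI[of _ "1 + expr_time e + t"]) simp
  qed
next
  case (LFor v b c)
  let ?m = "set_cell m v 0 0"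
  have body: "\<exists>t\<le>poly (cost c) N. exec (compile c) x t (sem c x)"
    if "\<And>a. a \<in> bounds c \<Longrightarrow> x a = ?m a" for x
    using LFor.IH[of x] LFor.prems that by auto
  have "\<exists>t \<le> 6 + m b 0 * (12 + poly (cost c) N).
    exec (WhileNZ (Sub (Load b (Const 0)) (Load v (Const 0)))
         (Seq (compile c) (Store v (Const 0) (Add (Load v (Const 0)) (Const 1))))) ?m t
      (((\<lambda>x. set_cell (sem c x) v 0 (Suc (sem c x v 0))) ^^ (m b 0)) ?m)"
    using LFor.prems by (intro compile_LFor_exec[where C = "bounds c" and m = ?m] body) auto
  then obtain t where t: "t \<le> 6 + m b 0 * (12 + poly (cost c) N)"
    "exec (WhileNZ (Sub (Load b (Const 0)) (Load v (Const 0)))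
         (Seq (compile c) (Store v (Const 0) (Add (Load v (Const 0)) (Const 1))))) ?m t
      (sem (LFor v b c) m)" unfolding sem.simps by blast
  have "exec (Store v (Const 0) (Const 0)) m 3 ?m"
    using exec.Store[of v "Const 0" "Const 0" m] by (simp add: eval_nat_numeral)
  from exec.Seq[OF this t(2)] have "exec (compile (LFor v b c)) m (3 + t) (sem (LFor v b c) m)"
    by simp
  moreover have "3 + t \<le> poly (cost (LFor v b c)) N"
  proof -
    have "m b 0 * (12 + poly (cost c) N) \<le> N * (12 + poly (cost c) N)"
      using LFor.prems by (intro mult_right_mono) auto
    then have "3 + t \<le> 9 + N * (12 + poly (cost c) N)" using t(1) by linarith
    then show ?thesis by simp
  qed
  ultimately show ?case by blast
qed

text \<open>The whole program violates the disjointness asked for by \<open>compile_exec\<close>: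
  parsing writes array 3, the number of vertices, which bounds later loops. The two phases are
  therefore timed separately.\<close>

lemma exec_compile_Seq:
  assumes "counters_ok c" "bounds c \<inter> writes c = {}" "\<forall>b\<in>bounds c. m b 0 \<le> N"
    and "counters_ok d" "bounds d \<inter> writes d = {}" "\<forall>b\<in>bounds d. sem c m b 0 \<le> N"
  shows "\<exists>t \<le> poly (cost (c ;; d)) N. exec (compile (c ;; d)) m t (sem (c ;; d) m)"
proof -
  obtain t where t: "t \<le> poly (cost c) N" "exec (compile c) m t (sem c m)"
    using compile_exec[of c m N] assms by auto
  obtain u where u: "u \<le> poly (cost d) N" "exec (compile d) (sem c m) u (sem d (sem c m))"
    using compile_exec[of d "sem c m" N] assms by auto
  show ?thesis using exec.Seq[OF t(2) u(2)] t(1) u(1) by (auto intro!: exI[of _ "t + u"])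
qed

abbreviation Var :: "nat \<Rightarrow> expr" where "Var a \<equiv> Load a (Const 0)"

abbreviation LSet :: "nat \<Rightarrow> expr \<Rightarrow> lprog" where "LSet a e \<equiv> LStore a (Const 0) e"

text \<open>Truth is being nonzero, negation is truncated subtraction from 1, and plain
  \<open>Add\<close> serves as disjunction.\<close>

definition Not_e :: "expr \<Rightarrow> expr" where "Not_e e = Sub (Const 1) e"

definition And_e :: "expr \<Rightarrow> expr \<Rightarrow> expr" where
  "And_e e f = Sub (Const 1) (Add (Sub (Const 1) e) (Sub (Const 1) f))"

definition Less_e :: "expr \<Rightarrow> expr \<Rightarrow> expr" where
  "Less_e e f = Sub (Const 1) (Sub (Add e (Const 1)) f)"

definition Eq_e :: "expr \<Rightarrow> expr \<Rightarrow> expr" where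
  "Eq_e e f = Sub (Const 1) (Add (Sub e f) (Sub f e))"

lemma expr_val_logic [simp]:
  "0 < expr_val (Not_e e) m \<longleftrightarrow> expr_val e m = 0"
  "0 < expr_val (And_e e f) m \<longleftrightarrow> 0 < expr_val e m \<and> 0 < expr_val f m"
  "0 < expr_val (Less_e e f) m \<longleftrightarrow> expr_val e m < expr_val f m"
  "0 < expr_val (Eq_e e f) m \<longleftrightarrow> expr_val e m = expr_val f m"
  by (auto simp: Not_e_def And_e_def Less_e_def Eq_e_def)

section \<open>Independent sets of sP2-free graphs\<close>

text \<open>Symmetry and irreflexivity are asked only below \<open>n\<close>, since \<open>A\<close>
  will be a raw memory lookup that returns unrelated bits for larger arguments.\<close>

locale index_graph =
  fixes n :: nat and T :: "nat \<Rightarrow> bool" and A :: "nat \<Rightarrow> nat \<Rightarrow> bool"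
  assumes A_sym: "x < n \<Longrightarrow> y < n \<Longrightarrow> A x y \<Longrightarrow> A y x"
    and A_irrefl: "x < n \<Longrightarrow> \<not> A x x"
begin

text \<open>The cutoff \<open>x < v j\<close> protects the target set \<open>J\<close>: if
  \<open>v j\<close> is the first member of \<open>J\<close> adjacent to \<open>u j\<close>, then no
  member below \<open>v j\<close> is adjacent to \<open>u j\<close>, and no member at all to
  \<open>v j\<close>.\<close>

definition excluded :: "(nat \<Rightarrow> nat) \<Rightarrow> (nat \<Rightarrow> nat) \<Rightarrow> nat \<Rightarrow> nat \<Rightarrow> bool" where
  "excluded v u r x \<longleftrightarrow> (\<exists>j<r. x < v j \<and> (A x (v j) \<or> A x (u j) \<or> x = u j))"

text \<open>A fixpoint equation rather than a recursion, so that it can be checked both of a given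
  maximal independent set and of the array filled by the program.\<close>

definition greedy :: "(nat \<Rightarrow> nat) \<Rightarrow> (nat \<Rightarrow> nat) \<Rightarrow> nat \<Rightarrow> (nat \<Rightarrow> bool) \<Rightarrow> bool" where
  "greedy v u r I \<longleftrightarrow>
     (\<forall>x<n. I x \<longleftrightarrow> T x \<and> (\<forall>y<x. I y \<longrightarrow> \<not> A x y) \<and> \<not> excluded v u r x)"

definition independent :: "(nat \<Rightarrow> bool) \<Rightarrow> bool" where
  "independent I \<longleftrightarrow> (\<forall>x<n. I x \<longrightarrow> T x) \<and> (\<forall>x<n. \<forall>y<n. I x \<longrightarrow> I y \<longrightarrow> \<not> A x y)"

definition maximal :: "(nat \<Rightarrow> bool) \<Rightarrow> bool" where
  "maximal I \<longleftrightarrow> (\<forall>x<n. T x \<longrightarrow> \<not> I x \<longrightarrow> (\<exists>y<n. I y \<and> A x y))"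

definition induced_matching :: "(nat \<Rightarrow> nat) \<Rightarrow> (nat \<Rightarrow> nat) \<Rightarrow> nat \<Rightarrow> bool" where
  "induced_matching v u r \<longleftrightarrow>
     (\<forall>j<r. v j < n \<and> u j < n \<and> T (v j) \<and> T (u j) \<and> A (v j) (u j)) \<and>
     (\<forall>i<r. \<forall>j<r. i \<noteq> j \<longrightarrow> v i \<noteq> v j \<and> u i \<noteq> u j \<and> v i \<noteq> u j \<and>
        \<not> A (v i) (v j) \<and> \<not> A (u i) (u j) \<and> \<not> A (v i) (u j))"

definition cover :: "nat set \<Rightarrow> bool" where
  "cover S \<longleftrightarrow> S \<subseteq> {..<n} \<and> (\<forall>x<n. \<forall>y<n. A x y \<longrightarrow> T x \<or> T y \<longrightarrow> x \<in> S \<or> y \<in> S)"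

lemma excluded_Suc:
  "excluded v u (Suc r) x \<longleftrightarrow>
     excluded v u r x \<or> x < v r \<and> (A x (v r) \<or> A x (u r) \<or> x = u r)"
  by (auto simp: excluded_def less_Suc_eq)

text \<open>Valid for arbitrary advice; this is what lets \<open>auction_final\<close> apply to
  every candidate, not only to maximal ones.\<close>

lemma greedy_independent:
  assumes "greedy v u r I"
  shows "independent I"
proof -
  have "\<not> A x y" if "x < n" "y < n" "I x" "I y" for x y
  proof -
    have *: "\<not> A x y" if "x < n" "y < x" "I x" "I y" for x y
      using assms that unfolding greedy_def by blast
    show ?thesis
    proof (cases x y rule: linorder_cases)
      case less
      then show ?thesis using *[of y x] A_sym[of x y] that by blast
    next
      case equal
      then show ?thesis using A_irrefl that by blast
    next
      case greater
      then show ?thesis using *[of x y] that by blast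
    qed
  qed
  moreover have "T x" if "x < n" "I x" for x using assms that unfolding greedy_def by blast
  ultimately show ?thesis unfolding independent_def by blast
qed

lemma greedy_unique:
  assumes "greedy v u r I" "greedy v u r J" "x < n"
  shows "I x = J x"
  using assms(3)
proof (induction x rule: less_induct)
  case (less x)
  have "\<forall>y<x. I y = J y" using less by auto
  then show ?case using assms(1,2) less.prems unfolding greedy_def by blast
qed

lemma independent_extend:
  assumes "independent I"
  shows "\<exists>J. independent J \<and> maximal J \<and> (\<forall>x<n. I x \<longrightarrow> J x)"
proof -
  define Q where "Q = (\<lambda>J. independent J \<and> (\<forall>x<n. I x \<longrightarrow> J x))"
  define f where "f = (\<lambda>J. card {x. x < n \<and> J x})"
  have "f J < n + 1" for J
  proof -
    have "f J \<le> card {..<n}" unfolding f_def by (intro card_mono) auto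
    then show ?thesis by simp
  qed
  then obtain J where J: "Q J" "\<And>K. Q K \<Longrightarrow> f K \<le> f J"
    using ex_has_greatest_nat[of Q I f "n + 1"] assms by (auto simp: Q_def)
  have "maximal J"
    unfolding maximal_def
  proof (intro allI impI, rule ccontr)
    fix x assume x: "x < n" "T x" "\<not> J x" and no: "\<not> (\<exists>y<n. J y \<and> A x y)"
    define K where "K = J(x := True)"
    have "\<not> A z y" if "z < n" "y < n" "K z" "K y" for z y
      using that J(1) no A_irrefl A_sym x(1) unfolding Q_def independent_def K_def
      by (metis fun_upd_apply)
    then have "Q K" using J(1) x by (auto simp: Q_def independent_def K_def)
    moreover have "{y. y < n \<and> K y} = insert x {y. y < n \<and> J y}"
      using x by (auto simp: K_def)
    then have "f K = Suc (f J)" using x by (simp add: f_def)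
    ultimately show False using J(2) by fastforce
  qed
  then show ?thesis using J(1) by (auto simp: Q_def)
qed

text \<open>
  Let \<open>J\<close> be a maximal independent set that differs from a greedy set. Among the non-members that
  greedy would take, choose \<open>x\<close> such that its first neighbour \<open>y\<close> in \<open>J\<close> is as large as possible,
  and forbid, below \<open>y\<close>, everything adjacent to \<open>y\<close> or \<open>x\<close>. The edges \<open>(y, x)\<close> found in this way
  form an induced matching, so that the process stops within \<open>s - 1\<close> rounds.
\<close>

lemma maximal_greedy:
  assumes ind: "independent J" and max: "maximal J"
    and free: "\<And>v u. \<not> induced_matching v u s"
  shows "\<exists>v u r. r < s \<and> greedy v u r J \<and> (\<forall>j<r. v j < n \<and> u j < n)"
proof -
  define bad where "bad = (\<lambda>v u r x. x < n \<and> T x \<and> \<not> J x \<and> (\<forall>y<x. J y \<longrightarrow> \<not> A x y) \<and>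
    \<not> excluded v u r x)"
  define nb where "nb = (\<lambda>x. LEAST y. y < n \<and> J y \<and> A x y)"
  \<comment> \<open>The \<open>v j\<close> decrease, because the largest first neighbour is always
    picked. Hence \<open>u i < v i < v j\<close> for \<open>j < i\<close>, so \<open>u i\<close>
    lies in the range of the exclusion by pair \<open>j\<close>; not being excluded, it is adjacent
    to neither \<open>v j\<close> nor \<open>u j\<close>.\<close>
  define good where "good = (\<lambda>v u r.
     (\<forall>j<r. u j < n \<and> T (u j) \<and> \<not> J (u j) \<and> v j = nb (u j) \<and> u j < v j) \<and>
     (\<forall>i<r. \<forall>j<i. v i < v j \<and> \<not> excluded v u i (u i)) \<and>
     (\<forall>x. bad v u r x \<longrightarrow> (\<forall>j<r. nb x < v j)))"
  have nb: "nb x < n" "J (nb x)" "A x (nb x)" "\<And>y. y < nb x \<Longrightarrow> y < n \<Longrightarrow> J y \<Longrightarrow> \<not> A x y"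
    if x: "x < n" "T x" "\<not> J x" for x
  proof -
    have "\<exists>y. y < n \<and> J y \<and> A x y" using max x by (auto simp: maximal_def)
    from LeastI_ex[OF this] show "nb x < n" "J (nb x)" "A x (nb x)" by (auto simp: nb_def)
    show "\<not> A x y" if "y < nb x" "y < n" "J y" for y
      using not_less_Least[of y "\<lambda>y. y < n \<and> J y \<and> A x y"] that by (auto simp: nb_def)
  qed
  \<comment> \<open>By maximality a first neighbour in \<open>J\<close> exists; below
    \<open>x\<close> it would have kept greedy from taking \<open>x\<close>.\<close>
  have bad_nb: "x < nb x" if "bad v u r x" for v u r x
    using that nb[of x] A_irrefl[of x] unfolding bad_def by (metis linorder_neqE_nat)
  have noJ: "\<not> A x y" if "x < n" "y < n" "J x" "J y" for x y
    using ind that by (auto simp: independent_def)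
  have TJ: "T x" if "x < n" "J x" for x using ind that by (auto simp: independent_def)
  have exJ: "\<not> excluded v u r x" if g: "good v u r" and x: "x < n" "J x" for v u r x
  proof
    assume "excluded v u r x"
    then obtain j where j: "j < r" "x < v j" "A x (v j) \<or> A x (u j) \<or> x = u j"
      by (auto simp: excluded_def)
    have uj: "u j < n" "T (u j)" "\<not> J (u j)" "v j = nb (u j)" using g j(1) by (auto simp: good_def)
    have "\<not> A x (v j)" using noJ nb(1,2)[OF uj(1-3)] uj(4) x by metis
    moreover have "\<not> A (u j) x" using nb(4)[OF uj(1-3), of x] uj(4) j(2) x by simp
    then have "\<not> A x (u j)" using A_sym[of x "u j"] x(1) uj(1) by blast
    ultimately show False using j(3) uj(3) x by auto
  qed
  have stop: "greedy v u r J" if g: "good v u r" and nobad: "\<And>x. \<not> bad v u r x" for v u r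
    unfolding greedy_def
  proof (intro allI impI iffI)
    fix x assume "x < n" "J x"
    then show "T x \<and> (\<forall>y<x. J y \<longrightarrow> \<not> A x y) \<and> \<not> excluded v u r x"
      using exJ[OF g] noJ TJ by auto
  next
    fix x assume "x < n" "T x \<and> (\<forall>y<x. J y \<longrightarrow> \<not> A x y) \<and> \<not> excluded v u r x"
    then show "J x" using nobad[of x] by (auto simp: bad_def)
  qed
  have step: "\<exists>v u. good v u (Suc r)" if g: "good v u r" and b: "bad v u r x0" for v u r x0
  proof -
    have "nb x < n + 1" if "bad v u r x" for x using nb(1)[of x] that by (auto simp: bad_def)
    then obtain x where x: "bad v u r x" "\<And>x'. bad v u r x' \<Longrightarrow> nb x' \<le> nb x"
      using ex_has_greatest_nat[of "bad v u r" x0 nb "n + 1"] b by blast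
    let ?v = "v(r := nb x)" and ?u = "u(r := x)"
    have ex_eq: "excluded ?v ?u i y = excluded v u i y" if "i \<le> r" for i y
      using that unfolding excluded_def by (intro ex_cong1) auto
    have ex_Suc: "excluded ?v ?u (Suc r) y \<longleftrightarrow> excluded v u r y \<or>
        y < nb x \<and> (A y (nb x) \<or> A y x \<or> y = x)" for y
      by (simp add: excluded_Suc ex_eq)
    have xs: "x < n" "T x" "\<not> J x" "\<not> excluded v u r x" using x(1) by (auto simp: bad_def)
    \<comment> \<open>A vertex with the same first neighbour lies below it and is adjacent to it,
      hence is excluded by the new pair. This makes the inequality strict.\<close>
    have lt: "nb x' < nb x" if "bad ?v ?u (Suc r) x'" for x'
    proof -
      have x': "bad v u r x'" "x' < nb x \<Longrightarrow> \<not> A x' (nb x)"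
        using that by (auto simp: bad_def ex_Suc)
      have "nb x' \<noteq> nb x"
        using x' bad_nb[OF x'(1)] nb(3)[of x'] by (auto simp: bad_def)
      with x(2)[OF x'(1)] show ?thesis by simp
    qed
    have "good ?v ?u (Suc r)"
      unfolding good_def
    proof (intro conjI allI impI)
      fix j assume j: "j < Suc r"
      show "?u j < n" "T (?u j)" "\<not> J (?u j)" "?v j = nb (?u j)" "?u j < ?v j"
        using j g xs bad_nb[OF x(1)] by (auto simp: good_def less_Suc_eq)
    next
      fix i j assume i: "i < Suc r" and j: "j < i"
      have "nb x < v j" if "j < r" for j using g x(1) that by (auto simp: good_def)
      then show "?v i < ?v j" using i j g by (auto simp: good_def less_Suc_eq)
      show "\<not> excluded ?v ?u i (?u i)"
        using i j g xs ex_eq[of i] by (auto simp: good_def less_Suc_eq)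
    next
      fix x' j assume x': "bad ?v ?u (Suc r) x'" and j: "j < Suc r"
      have "bad v u r x'" using x' by (auto simp: bad_def ex_Suc)
      then show "nb x' < ?v j" using lt[OF x'] j g by (auto simp: good_def less_Suc_eq)
    qed
    then show ?thesis by blast
  qed
  have matching: "induced_matching v u r" if g: "good v u r" for v u r
  proof -
    have uj: "u j < n" "T (u j)" "\<not> J (u j)" "v j = nb (u j)" "u j < v j" if "j < r" for j
      using g that by (auto simp: good_def)
    have vj: "v j < n" "J (v j)" "A (u j) (v j)" if "j < r" for j
      using nb[OF uj(1-3)[OF that]] uj(4)[OF that] by auto
    have ord: "v i < v j" "\<not> A (u i) (v j)" "\<not> A (u i) (u j)" "u i \<noteq> u j" if "i < r" "j < i" for i j
    proof -
      show l: "v i < v j" using g that by (auto simp: good_def)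
      have "\<not> excluded v u i (u i)" "u i < v i" using g that by (auto simp: good_def)
      then show "\<not> A (u i) (v j)" "\<not> A (u i) (u j)" "u i \<noteq> u j"
        using that l unfolding excluded_def by (meson order.strict_trans)+
    qed
    \<comment> \<open>Here the reason is different: \<open>v i\<close> is a member of
      \<open>J\<close> below \<open>v j\<close>, and no pair excludes a member of
      \<open>J\<close>.\<close>
    have ord2: "\<not> A (v i) (u j)" if "i < r" "j < i" for i j
    proof -
      have "\<not> excluded v u r (v i)" using exJ[OF g] vj that by auto
      then show ?thesis using that ord(1)[OF that] by (auto simp: excluded_def)
    qed
    show ?thesis
      unfolding induced_matching_def
    proof (intro conjI allI impI)
      fix j assume j: "j < r"
      show "v j < n" "u j < n" "T (v j)" "T (u j)" "A (v j) (u j)"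
        using uj[OF j] vj[OF j] TJ A_sym by blast+
    next
      fix i j assume ij: "i < r" "j < r" "i \<noteq> j"
      then have c: "j < i \<or> i < j" by auto
      show "v i \<noteq> v j" using c ord(1)[OF ij(1)] ord(1)[OF ij(2)] by force
      show "u i \<noteq> u j" using c ord(4)[OF ij(1)] ord(4)[OF ij(2)] by force
      show "v i \<noteq> u j" using uj(3)[OF ij(2)] vj(2)[OF ij(1)] by force
      show "\<not> A (v i) (v j)" using noJ vj ij by auto
      show "\<not> A (u i) (u j)"
        using c ord(3)[OF ij(1)] ord(3)[OF ij(2)] A_sym[OF uj(1)[OF ij(1)] uj(1)[OF ij(2)]] by blast
      show "\<not> A (v i) (u j)"
        using c ord(2)[OF ij(2)] ord2[OF ij(1)] A_sym[OF vj(1)[OF ij(1)] uj(1)[OF ij(2)]] by blast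
    qed
  qed
  have main: "(\<exists>r<k. \<exists>v u. good v u r \<and> (\<forall>x. \<not> bad v u r x)) \<or> (\<exists>v u. good v u k)" for k
  proof (induction k)
    case 0
    then show ?case by (auto simp: good_def)
  next
    case (Suc k)
    then show ?case
    proof
      assume "\<exists>r<k. \<exists>v u. good v u r \<and> (\<forall>x. \<not> bad v u r x)"
      then show ?thesis using less_SucI by blast
    next
      assume "\<exists>v u. good v u k"
      then obtain v u where vu: "good v u k" by blast
      show ?thesis
      proof (cases "\<forall>x. \<not> bad v u k x")
        case True
        then show ?thesis using vu by blast
      next
        case False
        then show ?thesis using step[OF vu] by blast
      qed
    qed
  qed
  from main[of s] matching free obtain r v u where r: "r < s" "good v u r" "\<forall>x. \<not> bad v u r x"
    by blast
  have "v j < n \<and> u j < n" if "j < r" for j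
  proof -
    have "u j < n" "T (u j)" "\<not> J (u j)" "v j = nb (u j)"
      using r(2) that by (auto simp: good_def)
    then show ?thesis using nb(1)[of "u j"] by simp
  qed
  then show ?thesis using r stop[OF r(2)] by blast
qed

text \<open>
  The pair \<open>(0, 0)\<close> excludes nothing, so that it can be used for padding. For \<open>n = 0\<close> this
  needs the range \<open>L \<ge> 1\<close>; out-of-range pairs are harmless, since every greedy set is independent.
\<close>

lemma cover_iff_greedy:
  assumes free: "\<And>v u. \<not> induced_matching v u s" and "L \<ge> n" "L \<ge> 1"
  shows "(\<exists>S. cover S \<and> card S \<le> k) \<longleftrightarrow>
    (\<exists>v u I S. (\<forall>j<s - 1. v j < L \<and> u j < L) \<and> (\<forall>j\<ge>s - 1. v j = 0 \<and> u j = 0) \<and>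
       greedy v u (s - 1) I \<and>
       cover S \<and> {x. x < n \<and> T x \<and> \<not> I x} \<subseteq> S \<and> card S \<le> k)" (is "?l \<longleftrightarrow> ?r")
proof
  assume ?l
  then obtain S where S: "cover S" "card S \<le> k" by auto
  have "independent (\<lambda>x. T x \<and> x \<notin> S)"
    using S(1) by (auto simp: independent_def cover_def)
  from independent_extend[OF this]
  obtain J where J: "independent J" "maximal J" "\<forall>x<n. T x \<and> x \<notin> S \<longrightarrow> J x"
    by (elim exE conjE)
  from maximal_greedy[OF J(1,2) free]
  obtain v u r where r: "r < s" "greedy v u r J" "\<forall>j<r. v j < n \<and> u j < n"
    by (elim exE conjE)
  let ?v = "\<lambda>j. if j < r then v j else 0" and ?u = "\<lambda>j. if j < r then u j else 0"
  have "excluded ?v ?u (s - 1) x = excluded v u r x" for x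
    unfolding excluded_def
  proof (rule ex_cong1)
    fix j
    show "(j < s - 1 \<and> x < ?v j \<and> (A x (?v j) \<or> A x (?u j) \<or> x = ?u j)) =
        (j < r \<and> x < v j \<and> (A x (v j) \<or> A x (u j) \<or> x = u j))"
      using r(1) by (cases "j < r") auto
  qed
  then have "greedy ?v ?u (s - 1) J" using r(2) by (simp add: greedy_def)
  moreover have "?v j < L \<and> ?u j < L" for j using r(3) assms(2,3) by auto
  moreover have "?v j = 0 \<and> ?u j = 0" if "j \<ge> s - 1" for j using r(1) that by auto
  moreover have "{x. x < n \<and> T x \<and> \<not> J x} \<subseteq> S" using J(3) by blast
  ultimately show ?r using S by (intro exI[of _ ?v] exI[of _ ?u] exI[of _ J] exI[of _ S]) simp
qed auto

section \<open>Bipartite matching by auction\<close>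

text \<open>
  Each vertex outside \<open>T\<close> carries a price \<open>p\<close>; \<open>q a = Suc b\<close> means that \<open>a\<close> is currently matched
  to \<open>b\<close>, and \<open>q a = 0\<close> that \<open>a\<close> is unmatched. An unmatched vertex \<open>a\<close> takes over a cheapest
  neighbour and raises its price by one.
\<close>

definition auction :: "(nat \<Rightarrow> bool) \<Rightarrow> (nat \<Rightarrow> nat) \<Rightarrow> (nat \<Rightarrow> nat) \<Rightarrow> bool" where
  "auction I q p \<longleftrightarrow>
     (\<forall>a<n. \<forall>b. q a = Suc b \<longrightarrow> I a \<and> b < n \<and> \<not> T b \<and> A a b \<and>
        (\<forall>c<n. \<not> T c \<longrightarrow> A a c \<longrightarrow> p b \<le> Suc (p c))) \<and>
     (\<forall>a<n. \<forall>a'<n. q a = q a' \<longrightarrow> q a \<noteq> 0 \<longrightarrow> a = a') \<and>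
     (\<forall>b<n. p b \<noteq> 0 \<longrightarrow> (\<exists>a<n. q a = Suc b)) \<and>
     (\<forall>b<n. p b \<le> Suc n)"

definition bidding :: "(nat \<Rightarrow> bool) \<Rightarrow> (nat \<Rightarrow> nat) \<Rightarrow> nat \<Rightarrow> nat \<Rightarrow> bool" where
  "bidding I q a b \<longleftrightarrow> a < n \<and> b < n \<and> I a \<and> q a = 0 \<and> \<not> T b \<and> A a b"

lemma auctionD:
  assumes "auction I q p"
  shows "\<forall>a<n. \<forall>b. q a = Suc b \<longrightarrow> I a \<and> b < n \<and> \<not> T b \<and> A a b \<and>
        (\<forall>c<n. \<not> T c \<longrightarrow> A a c \<longrightarrow> p b \<le> Suc (p c))"
    and "\<forall>a<n. \<forall>a'<n. q a = q a' \<longrightarrow> q a \<noteq> 0 \<longrightarrow> a = a'"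
    and "\<forall>b<n. p b \<noteq> 0 \<longrightarrow> (\<exists>a<n. q a = Suc b)"
    and "\<forall>b<n. p b \<le> Suc n"
  using assms unfolding auction_def by - (elim conjE, assumption)+

text \<open>The new pair satisfies the price inequality because its target was cheapest before the
  rise by one. In every other surviving pair the target keeps its price, as the previous holder of
  \<open>b\<close> is released, and the prices it is compared with can only grow.\<close>

lemma auction_bid:
  assumes inv: "auction I q p" and bid: "bidding I q a b" and p: "p b \<le> n"
    and min: "\<And>c. bidding I q a c \<Longrightarrow> p b \<le> p c"
    and q': "\<And>x. x < n \<Longrightarrow> q' x = (if x = a then Suc b else if q x = Suc b then 0 else q x)"
    and p': "\<And>x. x < n \<Longrightarrow> p' x = (if x = b then Suc (p b) else p x)"
  shows "auction I q' p'"
  unfolding auction_def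
proof (intro conjI allI impI)
  have b: "a < n" "b < n" "I a" "q a = 0" "\<not> T b" "A a b" using bid by (auto simp: bidding_def)
  have mono: "p c \<le> p' c" if "c < n" for c using p'[OF that] by simp
  have old: "I x \<and> y < n \<and> \<not> T y \<and> A x y \<and> (\<forall>c<n. \<not> T c \<longrightarrow> A x c \<longrightarrow> p y \<le> Suc (p c))"
    if "x < n" "q x = Suc y" for x y
    using auctionD(1)[OF inv, rule_format, OF that] by blast
  have old_inj: "x = y" if "x < n" "y < n" "q x = q y" "q x \<noteq> 0" for x y
    using auctionD(2)[OF inv, rule_format, OF that(1,2,3)] that(4) by blast
  {
    fix x y assume x: "x < n" "q' x = Suc y"
    show "I x" "y < n" "\<not> T y" "A x y"
      using x q'[OF x(1)] b old[of x y] by (auto split: if_splits)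
    fix c assume c: "c < n" "\<not> T c" "A x c"
    show "p' y \<le> Suc (p' c)"
    proof (cases "x = a")
      case True
      then have "p' y = Suc (p b)" using x q'[of x] p' b by simp
      moreover have "p b \<le> p c" using min[of c] b c True by (simp add: bidding_def)
      ultimately show ?thesis using mono[OF c(1)] by simp
    next
      case False
      then have "q x = Suc y" "y \<noteq> b" using x q'[OF x(1)] by (auto split: if_splits)
      then have "p y \<le> Suc (p c)" "y < n" using old[OF x(1)] c by auto
      then show ?thesis using p'[of y] \<open>y \<noteq> b\<close> mono[OF c(1)] by simp
    qed
  }
  {
    fix x y assume "x < n" "y < n" "q' x = q' y" "q' x \<noteq> 0"
    then show "x = y"
      using q'[of x] q'[of y] old_inj[of x y] by (auto split: if_splits)
  }
  {
    fix y assume y: "y < n" "p' y \<noteq> 0"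
    show "\<exists>x<n. q' x = Suc y"
    proof (cases "y = b")
      case True
      then show ?thesis using b(1) q'[of a] by auto
    next
      case False
      then have "p y \<noteq> 0" using y p' by simp
      then obtain x where "x < n" "q x = Suc y" using auctionD(3)[OF inv] y(1) by blast
      then show ?thesis using False q'[of x] b(4) by (intro exI[of _ x]) auto
    qed
  }
  {
    fix y assume "y < n"
    then show "p' y \<le> Suc n" using p'[of y] auctionD(4)[OF inv] p by simp
  }
qed

text \<open>
  Once nobody bids any more, some price level \<open>l\<close> is not attained. The vertices priced above \<open>l\<close>
  together with the vertices matched below \<open>l\<close> form a cover of the size of the matching.
\<close>

lemma auction_final:
  assumes ind: "independent I" and inv: "auction I q p"
    and final: "\<And>a b. bidding I q a b \<Longrightarrow> n < p b"
  shows "card {x. x < n \<and> (T x \<and> \<not> I x \<or> q x \<noteq> 0)} \<le> k \<longleftrightarrow>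
    (\<exists>S. cover S \<and> {x. x < n \<and> T x \<and> \<not> I x} \<subseteq> S \<and> card S \<le> k)" (is "card ?M \<le> k \<longleftrightarrow> ?r")
proof
  have q: "I a" "b < n" "\<not> T b" "A a b" if "a < n" "q a = Suc b" for a b
    using auctionD(1)[OF inv, rule_format, OF that] by blast+
  have cheap: "p b \<le> Suc (p c)" if "a < n" "q a = Suc b" "c < n" "\<not> T c" "A a c" for a b c
    using auctionD(1)[OF inv, rule_format, OF that(1,2)] that(3-) by blast
  have inj: "a = a'" if "a < n" "a' < n" "q a = Suc b" "q a' = Suc b" for a a' b
    using auctionD(2)[OF inv, rule_format, OF that(1,2)] that(3,4) by simp
  have matched: "\<exists>a<n. q a = Suc b" if "b < n" "p b \<noteq> 0" for b
    using auctionD(3)[OF inv] that by blast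
  have fin: "finite ?M" by simp
  {
    assume "card ?M \<le> k"
    \<comment> \<open>There are \<open>n\<close> prices but \<open>n + 1\<close> positive levels up
      to \<open>Suc n\<close>; this pigeonhole determines the price at which bidding may
      stop.\<close>
    have "\<not> {1..Suc n} \<subseteq> p ` {..<n}"
    proof
      assume "{1..Suc n} \<subseteq> p ` {..<n}"
      then have "card {1..Suc n} \<le> card (p ` {..<n})" by (intro card_mono) auto
      also have "\<dots> \<le> card {..<n}" by (rule card_image_le) simp
      finally show False by simp
    qed
    then obtain l where l: "1 \<le> l" "l \<le> Suc n" "\<And>b. b < n \<Longrightarrow> p b \<noteq> l" by fastforce
    define U where "U = {x. x < n \<and> T x \<and> \<not> I x}"
    define B where "B = {b. b < n \<and> \<not> T b \<and> l < p b}"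
    define C where "C = {a. a < n \<and> (\<exists>b. q a = Suc b \<and> p b < l)}"
    \<comment> \<open>A price above \<open>l \<ge> 1\<close> is nonzero, so vertices of
      \<open>B\<close> are matched. Counting their partners instead stays within \<open>?M\<close>
      without overlap: partners lie in \<open>I\<close>, hence outside \<open>U\<close>, and are
      matched above \<open>l\<close>, hence outside \<open>C\<close>.\<close>
    define partner where "partner = (\<lambda>b. SOME a. a < n \<and> q a = Suc b)"
    have partner: "partner b < n" "q (partner b) = Suc b" if "b \<in> B" for b
      using someI_ex[OF matched[of b]] that l(1) by (auto simp: B_def partner_def)
    have B': "card B = card (partner ` B)"
      by (intro card_image[symmetric] inj_onI) (metis partner(2) nat.inject)
    have sub: "U \<union> C \<union> partner ` B \<subseteq> ?M"
      using partner by (auto simp: U_def C_def)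
    have "card (U \<union> C \<union> B) \<le> card (U \<union> C) + card (partner ` B)"
      using B' card_Un_le[of "U \<union> C" B] by simp
    also have "\<dots> = card (U \<union> C \<union> partner ` B)"
    proof (rule card_Un_disjoint[symmetric])
      have "partner b \<notin> U \<union> C" if "b \<in> B" for b
        using partner[OF that] q(1)[of "partner b" b] that by (auto simp: U_def C_def B_def)
      then show "(U \<union> C) \<inter> partner ` B = {}" by blast
    qed (auto simp: U_def C_def B_def)
    also have "\<dots> \<le> card ?M" using sub fin by (rule card_mono[rotated])
    finally have "card (U \<union> C \<union> B) \<le> k" using \<open>card ?M \<le> k\<close> by simp
    moreover have one: "a \<in> U \<union> C \<union> B \<or> b \<in> U \<union> C \<union> B"
      if ab: "a < n" "b < n" "A a b" "T a" for a b
    proof (rule ccontr)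
      assume not: "\<not> ?thesis"
      then have I: "I a" using ab by (auto simp: U_def)
      have "\<not> T b"
      proof
        assume "T b"
        then have "I b" using not ab(2) by (auto simp: U_def)
        then show False using ind I ab unfolding independent_def by blast
      qed
      have "p b < l" using not ab(2) \<open>\<not> T b\<close> l(3)[of b] by (auto simp: B_def)
      show False
      proof (cases "q a")
        case 0
        then have "n < p b" using final[of a b] ab I \<open>\<not> T b\<close> by (auto simp: bidding_def)
        then show False using \<open>p b < l\<close> l(2) by simp
      next
        case (Suc c)
        \<comment> \<open>The price inequality loses one unit, which the gap at \<open>l\<close>
          absorbs: \<open>p c\<close> is at most \<open>l\<close> and differs from it.\<close>
        have "p c \<le> l" using cheap[OF ab(1) Suc ab(2) \<open>\<not> T b\<close> ab(3)] \<open>p b < l\<close> by simp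
        then have "p c < l" using l(3)[of c] q(2)[OF ab(1) Suc] by force
        then show False using not ab(1) Suc by (auto simp: C_def)
      qed
    qed
    then have "a \<in> U \<union> C \<union> B \<or> b \<in> U \<union> C \<union> B"
      if "a < n" "b < n" "A a b" "T a \<or> T b" for a b
      using that A_sym by blast
    then have "cover (U \<union> C \<union> B)"
      unfolding cover_def by (auto simp: U_def C_def B_def)
    ultimately show ?r unfolding U_def by blast
  }
  {
    assume ?r
    then obtain S where S: "cover S" "{x. x < n \<and> T x \<and> \<not> I x} \<subseteq> S" "card S \<le> k" by blast
    \<comment> \<open>Weak duality: a matched vertex outside \<open>S\<close> forces its partner
      into \<open>S\<close>. Partners lie outside \<open>T\<close> and counted vertices inside, so
      the two kinds of images cannot collide; \<open>q x - 1\<close> undoes the \<open>Suc\<close>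
      in the encoding of \<open>q\<close>.\<close>
    define f where "f = (\<lambda>x. if x \<in> S then x else q x - 1)"
    have f: "f x \<in> S" if "x \<in> ?M" for x
    proof (cases "q x")
      case 0
      then show ?thesis using that S(2) by (auto simp: f_def)
    next
      case (Suc b)
      have "T x" using q(1)[of x b] Suc that ind by (auto simp: independent_def)
      then show ?thesis using S(1) q(2,4)[of x b] Suc that by (auto simp: f_def cover_def)
    qed
    have out: "\<not> T (f x)" "q x = Suc (f x)" if x: "x \<in> ?M" "x \<notin> S" for x
    proof -
      have "q x \<noteq> 0" using x S(2) by auto
      then obtain b where b: "q x = Suc b" using not0_implies_Suc by blast
      then show "\<not> T (f x)" "q x = Suc (f x)" using q(3)[of x b] x by (auto simp: f_def)
    qed
    have inT: "T x" if "x \<in> ?M" for x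
      using that q(1)[of x "q x - 1"] ind by (auto simp: independent_def)
    have "inj_on f ?M"
    proof (rule inj_onI)
      fix x y assume x: "x \<in> ?M" and y: "y \<in> ?M" and eq: "f x = f y"
      have fS: "f z = z" if "z \<in> S" for z using that by (simp add: f_def)
      show "x = y"
      proof (cases "x \<in> S"; cases "y \<in> S")
        assume "x \<notin> S" "y \<notin> S"
        then show ?thesis using out(2)[OF x] out(2)[OF y] eq inj[of x y "f x"] x y by auto
      qed (use eq fS out(1) inT x y in metis)+
    qed
    then have "card ?M = card (f ` ?M)" by (rule card_image[symmetric])
    also have "\<dots> \<le> card S"
      using f S(1) by (intro card_mono) (auto simp: cover_def intro: finite_subset[of S "{..<n}"])
    finally show "card ?M \<le> k" using S(3) by simp
  }
qed

end

section \<open>The program\<close>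

text \<open>
  Arrays: 0--2 as prescribed by the machine model, 3 the number \<open>n\<close> of vertices, 4 the start of
  each row of the adjacency matrix, 5 the number \<open>k\<close>, 6 the independent set, 7 and 8 the matching
  and the prices of the auction; the other arrays are scratch cells. The pairs that
  determine the greedy set are stored in arrays \<open>100 + 2 * j\<close> and \<open>101 + 2 * j\<close>.
\<close>

definition count_vertices :: lprog where
  "count_vertices =
     LFor 10 1 (LIf (Var 11) LSkip
       (LIf (Load 0 (Var 10)) (LSet 3 (Add (Var 3) (Const 1))) (LSet 11 (Const 1))))"

text \<open>Repeated addition replaces multiplication. Entry \<open>n\<close>, one past the last
  row, is where the bits of \<open>k\<close> start. Array 1 bounds the loop because array 3 is
  written during parsing and may not bound a loop there.\<close>

definition compute_rows :: lprog where
  "compute_rows =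
     LSet 4 (Add (Add (Var 3) (Var 3)) (Const 1)) ;;
     LFor 10 1 (LStore 4 (Add (Var 10) (Const 1)) (Add (Load 4 (Var 10)) (Var 3)))"

definition read_bound :: lprog where
  "read_bound =
     LSet 12 (Const 1) ;;
     LFor 10 1 (LIf (Less_e (Var 10) (Load 4 (Var 3))) LSkip
       (LIf (Load 0 (Var 10)) (LSet 5 (Add (Var 5) (Var 12))) LSkip ;;
        LSet 12 (Add (Var 12) (Var 12))))"

definition parse :: lprog where
  "parse = count_vertices ;; compute_rows ;; read_bound"

lemma sem_count_vertices:
  assumes "m 1 0 = L" "n < L" "\<And>i. i < n \<Longrightarrow> m 0 i \<noteq> 0" "m 0 n = 0" "m 3 0 = 0" "m 11 0 = 0"
  shows "sem count_vertices m 3 0 = n"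
proof -
  let ?P = "\<lambda>i x. x 3 0 = min i n \<and> x 11 0 = (if n < i then 1 else 0)"
  have "?P (m 1 0) (sem count_vertices m)"
    unfolding count_vertices_def
  proof (rule sem_LFor_induct[where P = ?P], goal_cases)
    case (3 i x)
    have "x 0 = m 0" using 3(2) by simp
    consider "i < n" | "i = n" | "n < i" by linarith
    then show ?case using 3 assms(3)[of i] assms(4) \<open>x 0 = m 0\<close> by cases auto
  qed (use assms in auto)
  then show ?thesis using assms(1,2) by simp
qed

lemma sem_compute_rows:
  assumes "m 1 0 = L" "m 3 0 = n" "i \<le> L"
  shows "sem compute_rows m 4 i = 2 * n + 1 + i * n"
proof -
  define m1 where "m1 = set_cell m 4 0 (2 * n + 1)"
  let ?P = "\<lambda>k x. \<forall>i\<le>k. x 4 i = 2 * n + 1 + i * n"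
  have "?P (m1 1 0)
      (sem (LFor 10 1 (LStore 4 (Add (Var 10) (Const 1)) (Add (Load 4 (Var 10)) (Var 3)))) m1)"
  proof (rule sem_LFor_induct[where P = ?P], goal_cases)
    case (3 k x)
    then show ?case using assms(2) by (auto simp: m1_def le_Suc_eq)
  qed (auto simp: m1_def)
  moreover have "m1 1 0 = L" using assms by (simp add: m1_def)
  ultimately show ?thesis
    using assms by (simp add: compute_rows_def m1_def mult_2)
qed

lemma sem_read_bound:
  assumes "m 1 0 = L" "m 4 (m 3 0) = off" "m 5 0 = 0" "\<And>i. m 0 i = of_bool (f i)"
  shows "sem read_bound m 5 0 = (\<Sum>i<L - off. of_bool (f (off + i)) * 2 ^ i)"
proof -
  define m1 where "m1 = set_cell m 12 0 1"
  let ?P = "\<lambda>k x. x 5 0 = (\<Sum>i<k - off. of_bool (f (off + i)) * 2 ^ i) \<and> x 12 0 = 2 ^ (k - off)"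
  have "?P (m1 1 0)
      (sem (LFor 10 1 (LIf (Less_e (Var 10) (Load 4 (Var 3))) LSkip
       (LIf (Load 0 (Var 10)) (LSet 5 (Add (Var 5) (Var 12))) LSkip ;;
        LSet 12 (Add (Var 12) (Var 12))))) m1)"
  proof (rule sem_LFor_induct[where P = ?P], goal_cases)
    case (3 k x)
    have x: "x 0 = m 0" "x 3 = m 3" "x 4 = m 4" using 3(2) by (simp_all add: m1_def)
    show ?case
    proof (cases "k < off")
      case True
      then show ?thesis using 3 x assms(2) by auto
    next
      case False
      then have "Suc k - off = Suc (k - off)" "off + (k - off) = k" by auto
      then show ?thesis using 3 x False assms(2,4) by auto
    qed
  qed (use assms in \<open>auto simp: m1_def\<close>)
  moreover have "m1 1 0 = L" using assms by (simp add: m1_def)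
  ultimately show ?thesis by (simp add: read_bound_def m1_def)
qed

lemma sum_nat_bits: "(\<Sum>i<length (nat_bits k). of_bool (nat_bits k ! i) * 2 ^ i) = k"
proof (induction k rule: nat_bits.induct)
  case (1 k)
  show ?case
  proof (cases "k = 0")
    case False
    then have *: "nat_bits k = odd k # nat_bits (k div 2)" by (subst nat_bits.simps) simp
    have "(\<Sum>i<length (nat_bits (k div 2)). of_bool (nat_bits (k div 2) ! i) * 2 ^ Suc i) =
        2 * (k div 2)"
      using 1[OF False] by (simp add: sum_distrib_left mult.left_commute flip: sum_distrib_left)
    then show ?thesis
      unfolding * by (simp add: sum.lessThan_Suc_shift del: sum.lessThan_Suc power_Suc)
  qed (simp add: nat_bits.simps)
qed

section \<open>The search loops\<close>

definition T_e :: "expr \<Rightarrow> expr" where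
  "T_e e = Load 0 (Add (Add (Var 3) (Const 1)) e)"

definition adj_e :: "expr \<Rightarrow> expr \<Rightarrow> expr" where
  "adj_e e f = Load 0 (Add (Load 4 e) f)"

text \<open>Array numbers are static, so the disjunction over the pairs is unrolled into the program
  text; this is possible because \<open>s\<close> is fixed.\<close>

primrec excluded_e :: "nat \<Rightarrow> expr" where
  "excluded_e 0 = Const 0"
| "excluded_e (Suc j) = Add (excluded_e j)
     (And_e (Less_e (Var 20) (Var (100 + 2 * j)))
       (Add (adj_e (Var 20) (Var (100 + 2 * j)))
         (Add (adj_e (Var 20) (Var (101 + 2 * j))) (Eq_e (Var 20) (Var (101 + 2 * j))))))"

definition clear_arrays :: lprog where
  "clear_arrays = LFor 20 3 (LStore 6 (Var 20) (Const 0) ;; LStore 7 (Var 20) (Const 0) ;;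
     LStore 8 (Var 20) (Const 0))"

definition check_neighbours :: lprog where
  "check_neighbours = LSet 21 (Const 0) ;;
     LFor 22 3 (LIf (And_e (Load 6 (Var 22)) (adj_e (Var 20) (Var 22))) (LSet 21 (Const 1)) LSkip)"

definition build_greedy :: "nat \<Rightarrow> lprog" where
  "build_greedy r = LFor 20 3 (check_neighbours ;;
     LIf (And_e (T_e (Var 20)) (Not_e (Add (Var 21) (excluded_e r))))
       (LStore 6 (Var 20) (Const 1)) LSkip)"

definition find_row :: lprog where
  "find_row = LFor 26 3
     (LIf (And_e (Not_e (T_e (Var 26)))
            (And_e (adj_e (Var 25) (Var 26)) (Less_e (Load 8 (Var 26)) (Var 24))))
       (LSet 24 (Load 8 (Var 26)) ;; LSet 27 (Var 25) ;; LSet 28 (Var 26)) LSkip)"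

text \<open>The initial \<open>n + 1\<close> is both the infinity of the minimum search and the
  price limit: dearer bids are never recorded.\<close>

definition find_bid :: lprog where
  "find_bid = LSet 24 (Add (Var 3) (Const 1)) ;;
     LFor 25 3 (LIf (And_e (Load 6 (Var 25)) (Not_e (Load 7 (Var 25)))) find_row LSkip)"

definition release :: lprog where
  "release = LFor 29 3 (LIf (Eq_e (Load 7 (Var 29)) (Add (Var 28) (Const 1)))
     (LStore 7 (Var 29) (Const 0)) LSkip)"

definition place_bid :: lprog where
  "place_bid = release ;;
     LStore 7 (Var 27) (Add (Var 28) (Const 1)) ;;
     LStore 8 (Var 28) (Add (Load 8 (Var 28)) (Const 1))"

definition bid_round :: lprog where
  "bid_round = find_bid ;; LIf (Less_e (Var 24) (Add (Var 3) (Const 1))) place_bid LSkip"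

definition count_cover :: lprog where
  "count_cover = LSet 30 (Const 0) ;;
     LFor 31 3 (LIf (Add (And_e (T_e (Var 31)) (Not_e (Load 6 (Var 31)))) (Load 7 (Var 31)))
       (LSet 30 (Add (Var 30) (Const 1))) LSkip)"

text \<open>Cell 0 of array 2 is set on success and never cleared, so repeated runs compute a
  disjunction; the work arrays are cleared in each run.\<close>

definition test_pairs :: "nat \<Rightarrow> lprog" where
  "test_pairs r = clear_arrays ;; build_greedy r ;; LFor 23 1 bid_round ;; count_cover ;;
     LIf (Less_e (Var 5) (Var 30)) LSkip (LSet 2 (Const 1))"

text \<open>The loop counters are the advice: they live in the very arrays from which
  \<open>excluded_e\<close> reads the pairs.\<close>

primrec all_pairs :: "nat \<Rightarrow> lprog \<Rightarrow> lprog" where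
  "all_pairs 0 c = c"
| "all_pairs (Suc j) c = LFor (100 + 2 * j) 1 (LFor (101 + 2 * j) 1 (all_pairs j c))"

lemmas program_defs = clear_arrays_def check_neighbours_def build_greedy_def find_row_def
  find_bid_def release_def place_bid_def bid_round_def count_cover_def test_pairs_def

lemma writes_simps [simp]:
  "writes check_neighbours = {21, 22}"
  "writes find_row = {24, 26, 27, 28}"
  "writes find_bid = {24, 25, 26, 27, 28}"
  "writes release = {7, 29}"
  "writes place_bid = {7, 8, 29}"
  "writes bid_round = {7, 8, 24, 25, 26, 27, 28, 29}"
  "writes clear_arrays = {6, 7, 8, 20}"
  "writes (build_greedy r) = {6, 20, 21, 22}"
  "writes count_cover = {30, 31}"
  "writes (test_pairs r) = {2, 6, 7, 8, 20, 21, 22, 23, 24, 25, 26, 27, 28, 29, 30, 31}"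
  by (auto simp: program_defs)

lemma counters_ok_simps [simp]:
  "counters_ok check_neighbours" "counters_ok find_row" "counters_ok find_bid"
  "counters_ok release" "counters_ok place_bid" "counters_ok bid_round"
  "counters_ok clear_arrays" "counters_ok (build_greedy r)" "counters_ok count_cover"
  "counters_ok (test_pairs r)"
  by (simp_all add: program_defs)

section \<open>Correctness of the test for fixed advice\<close>

locale svc_program = index_graph +
  fixes L k :: nat
  assumes L: "n * n + 2 * n + 1 \<le> L"
begin

text \<open>The second argument of \<open>A\<close> is unbounded: advice ranges below
  \<open>L\<close>, so \<open>excluded\<close> also queries \<open>A x y\<close> for
  \<open>y \<ge> n\<close>, and must see the same bit as the program.\<close>

definition env :: "memory \<Rightarrow> bool" where
  "env m \<longleftrightarrow> m 1 0 = L \<and> m 3 0 = n \<and> m 5 0 = k \<and>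
     (\<forall>x<n. m 0 (n + 1 + x) \<noteq> 0 \<longleftrightarrow> T x) \<and> (\<forall>x<n. \<forall>y. m 0 (m 4 x + y) \<noteq> 0 \<longleftrightarrow> A x y)"

lemma env_cong:
  assumes "\<And>a. a \<in> {0, 1, 3, 4, 5} \<Longrightarrow> m' a = m a"
  shows "env m' = env m"
  using assms by (simp add: env_def)

lemma T_e: "env m \<Longrightarrow> expr_val e m < n \<Longrightarrow> 0 < expr_val (T_e e) m \<longleftrightarrow> T (expr_val e m)"
  by (simp add: env_def T_e_def)

lemma adj_e:
  "env m \<Longrightarrow> expr_val e m < n \<Longrightarrow>
     0 < expr_val (adj_e e f) m \<longleftrightarrow> A (expr_val e m) (expr_val f m)"
  by (simp add: env_def adj_e_def)

lemma excluded_e: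
  assumes "env m" "m 20 0 < n"
  shows "0 < expr_val (excluded_e r) m \<longleftrightarrow>
    excluded (\<lambda>j. m (100 + 2 * j) 0) (\<lambda>j. m (101 + 2 * j) 0) r (m 20 0)"
proof (induction r)
  case 0
  then show ?case by (simp add: excluded_def)
next
  case (Suc r)
  then show ?case using assms by (simp add: excluded_Suc adj_e)
qed

lemma sem_clear_arrays:
  assumes "env m" "x < n"
  shows "sem clear_arrays m 6 x = 0 \<and> sem clear_arrays m 7 x = 0 \<and> sem clear_arrays m 8 x = 0"
proof -
  let ?P = "\<lambda>i m. \<forall>x<i. m 6 x = 0 \<and> m 7 x = 0 \<and> m 8 x = 0"
  have "?P (m 3 0) (sem clear_arrays m)"
    unfolding clear_arrays_def by (rule sem_LFor_induct[where P = ?P]) (auto simp: less_Suc_eq)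
  then show ?thesis using assms by (simp add: env_def)
qed

lemma sem_check_neighbours:
  assumes "env m" "m 20 0 < n"
  shows "sem check_neighbours m 21 0 \<noteq> 0 \<longleftrightarrow> (\<exists>z<n. m 6 z \<noteq> 0 \<and> A (m 20 0) z)"
proof -
  define m1 where "m1 = set_cell m 21 0 0"
  let ?P = "\<lambda>j x. x 21 0 \<noteq> 0 \<longleftrightarrow> (\<exists>z<j. m 6 z \<noteq> 0 \<and> A (m 20 0) z)"
  have "?P (m1 3 0)
    (sem (LFor 22 3 (LIf (And_e (Load 6 (Var 22)) (adj_e (Var 20) (Var 22)))
       (LSet 21 (Const 1)) LSkip)) m1)"
  proof (rule sem_LFor_induct[where P = ?P], goal_cases)
    case (3 j x)
    have "env x" using assms(1) 3(2) by (subst env_cong[of x m]) (auto simp: m1_def)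
    moreover have "x 20 = m 20" "x 6 = m 6" using 3(2) by (simp_all add: m1_def)
    ultimately show ?case using 3 assms(2) by (auto simp: adj_e less_Suc_eq)
  qed (auto simp: m1_def)
  moreover have "m1 3 0 = n" using assms by (simp add: m1_def env_def)
  ultimately show ?thesis by (simp add: check_neighbours_def m1_def)
qed

lemma sem_build_greedy:
  assumes "env m" "\<And>x. x < n \<Longrightarrow> m 6 x = 0"
  shows "greedy (\<lambda>j. m (100 + 2 * j) 0) (\<lambda>j. m (101 + 2 * j) 0) r (\<lambda>x. sem (build_greedy r) m 6 x \<noteq> 0)"
proof -
  let ?v = "\<lambda>j. m (100 + 2 * j) 0" and ?u = "\<lambda>j. m (101 + 2 * j) 0"
  \<comment> \<open>Entries from \<open>i\<close> on are still zero, so a scan over all vertices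
    finds only neighbours chosen below \<open>i\<close>.\<close>
  define G where "G = (\<lambda>i f. (\<forall>y<n. i \<le> y \<longrightarrow> f y = (0 :: nat)) \<and> (\<forall>y<i. f y \<noteq> 0 \<longleftrightarrow>
      T y \<and> (\<forall>z<y. f z \<noteq> 0 \<longrightarrow> \<not> A y z) \<and> \<not> excluded ?v ?u r y))"
  have step: "G (Suc i) g" if f: "G i f" and i: "i < n" and g: "g = (if T i \<and> \<not> (\<exists>z<i. f z \<noteq> 0 \<and> A i z) \<and>
      \<not> excluded ?v ?u r i then f(i := 1) else f)" (is "g = (if ?c then _ else _)") for i f g
  proof -
    have f1: "\<forall>y<n. i \<le> y \<longrightarrow> f y = 0"
      and f2: "\<forall>y<i. f y \<noteq> 0 \<longleftrightarrow>
        T y \<and> (\<forall>z<y. f z \<noteq> 0 \<longrightarrow> \<not> A y z) \<and> \<not> excluded ?v ?u r y"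
      using f unfolding G_def by - (elim conjE, assumption)+
    have eq: "g y = f y" if "y \<noteq> i" for y using g that by simp
    have "f i = 0" using f1 i by simp
    then have gi: "g i \<noteq> 0 \<longleftrightarrow> ?c" using g by simp
    have "g y = 0" if "y < n" "Suc i \<le> y" for y
    proof -
      have "f y = 0" using f1 that by simp
      then show ?thesis using eq that by simp
    qed
    moreover have "g y \<noteq> 0 \<longleftrightarrow> T y \<and> (\<forall>z<y. g z \<noteq> 0 \<longrightarrow> \<not> A y z) \<and> \<not> excluded ?v ?u r y"
      if "y < Suc i" for y
    proof (cases "y = i")
      case True
      have "(\<exists>z<i. f z \<noteq> 0 \<and> A i z) \<longleftrightarrow> (\<exists>z<i. g z \<noteq> 0 \<and> A i z)"
        by (rule ex_cong1) (use eq less_irrefl in metis)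
      then show ?thesis unfolding True gi by blast
    next
      case False
      then have "y < i" using that by simp
      then have "(\<forall>z<y. f z \<noteq> 0 \<longrightarrow> \<not> A y z) \<longleftrightarrow> (\<forall>z<y. g z \<noteq> 0 \<longrightarrow> \<not> A y z)"
        by (intro all_cong1 imp_cong refl) (use eq \<open>y < i\<close> in simp)
      moreover have "f y \<noteq> 0 \<longleftrightarrow> T y \<and> (\<forall>z<y. f z \<noteq> 0 \<longrightarrow> \<not> A y z) \<and> \<not> excluded ?v ?u r y"
        by (rule f2[rule_format, OF \<open>y < i\<close>])
      ultimately show ?thesis using eq[OF False] by presburger
    qed
    ultimately show ?thesis unfolding G_def by (intro conjI allI impI)
  qed
  let ?P = "\<lambda>i x. G i (x 6)"
  have "?P (m 3 0) (sem (build_greedy r) m)"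
    unfolding build_greedy_def
  proof (rule sem_LFor_induct[where P = ?P], goal_cases)
    case (3 i x)
    define y where "y = sem check_neighbours x"
    have y: "y a = x a" if "a \<notin> {21, 22}" for a
      unfolding y_def using that by (intro sem_frame) simp
    have i: "i < n" using 3(1) assms(1) by (simp add: env_def)
    have "env x" using assms(1) 3(2) by (subst env_cong[of x m]) auto
    moreover from this have "env y" using y by (subst env_cong[of y x]) auto
    ultimately have env: "env x" "env y" by auto
    have y21: "y 21 0 \<noteq> 0 \<longleftrightarrow> (\<exists>z<i. x 6 z \<noteq> 0 \<and> A i z)"
    proof -
      have zero: "\<forall>z<n. i \<le> z \<longrightarrow> x 6 z = 0" using 3(4) unfolding G_def by (rule conjunct1)
      have "y 21 0 \<noteq> 0 \<longleftrightarrow> (\<exists>z<n. x 6 z \<noteq> 0 \<and> A i z)"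
        using sem_check_neighbours[OF env(1)] 3(3) i by (simp add: y_def)
      also have "\<dots> \<longleftrightarrow> (\<exists>z<i. x 6 z \<noteq> 0 \<and> A i z)"
      proof (rule ex_cong1)
        show "z < n \<and> x 6 z \<noteq> 0 \<and> A i z \<longleftrightarrow> z < i \<and> x 6 z \<noteq> 0 \<and> A i z" for z
          using zero i by (cases "z < i") auto
      qed
      finally show ?thesis .
    qed
    have "0 < expr_val (excluded_e r) y \<longleftrightarrow> excluded ?v ?u r i"
      using excluded_e[OF env(2), of r] y 3(2,3) i by simp
    then have ec: "0 < expr_val (And_e (T_e (Var 20)) (Not_e (Add (Var 21) (excluded_e r)))) y \<longleftrightarrow>
        T i \<and> \<not> (\<exists>z<i. x 6 z \<noteq> 0 \<and> A i z) \<and> \<not> excluded ?v ?u r i" (is "?e \<longleftrightarrow> ?c")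
      using T_e[OF env(2), of "Var 20"] y 3(3) i y21 by auto
    have "set_cell (sem (check_neighbours ;; LIf (And_e (T_e (Var 20)) (Not_e (Add (Var 21) (excluded_e r))))
       (LStore 6 (Var 20) (Const 1)) LSkip) x) 20 0 (Suc i) 6 = (if ?e then (x 6)(i := 1) else x 6)"
      using y[of 6] y[of 20] 3(3) by (simp flip: y_def)
    then show ?case unfolding ec by (rule step[OF 3(4) i])
  qed (use assms in \<open>auto simp: G_def\<close>)
  moreover have "m 3 0 = n" using assms by (simp add: env_def)
  ultimately show ?thesis by (simp add: greedy_def G_def)
qed

section \<open>Auction rounds in memory\<close>

definition best_bid :: "memory \<Rightarrow> (nat \<times> nat) set \<Rightarrow> memory \<Rightarrow> bool" where
  "best_bid m R x \<longleftrightarrow> x 24 0 \<le> Suc n \<and>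
     (\<forall>a b. (a, b) \<in> R \<longrightarrow> bidding (\<lambda>x. m 6 x \<noteq> 0) (m 7) a b \<longrightarrow> x 24 0 \<le> m 8 b) \<and>
     (x 24 0 \<le> n \<longrightarrow> bidding (\<lambda>x. m 6 x \<noteq> 0) (m 7) (x 27 0) (x 28 0) \<and> m 8 (x 28 0) = x 24 0)"

lemma best_bid_better:
  assumes "best_bid m R x" "bidding (\<lambda>x. m 6 x \<noteq> 0) (m 7) a b" "m 8 b < x 24 0"
    and y: "y 24 0 = m 8 b" "y 27 0 = a" "y 28 0 = b"
  shows "best_bid m (insert (a, b) R) y"
proof -
  have "m 8 b \<le> m 8 b'" if "(a', b') \<in> insert (a, b) R" "bidding (\<lambda>x. m 6 x \<noteq> 0) (m 7) a' b'" for a' b'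
  proof (cases "(a', b') = (a, b)")
    case False
    then have "x 24 0 \<le> m 8 b'" using assms(1) that unfolding best_bid_def by blast
    then show ?thesis using assms(3) by simp
  qed simp
  moreover have "m 8 b \<le> Suc n" using assms(1,3) by (simp add: best_bid_def)
  ultimately show ?thesis unfolding best_bid_def y using assms(2) by blast
qed

lemma best_bid_keep:
  assumes "best_bid m R x" "\<not> (bidding (\<lambda>x. m 6 x \<noteq> 0) (m 7) a b \<and> m 8 b < x 24 0)"
    and y: "y 24 0 = x 24 0" "y 27 0 = x 27 0" "y 28 0 = x 28 0"
  shows "best_bid m (insert (a, b) R) y"
  using assms(1,2) unfolding best_bid_def y by (auto simp: not_less)

lemma sem_find_row:
  assumes "env m" "\<And>a. a \<notin> {24, 25, 26, 27, 28} \<Longrightarrow> x a = m a" "x 25 0 = a" "a < n"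
    and "m 6 a \<noteq> 0" "m 7 a = 0" and R: "best_bid m R x"
  shows "best_bid m (R \<union> {a} \<times> {..<n}) (sem find_row x)"
proof -
  let ?P = "\<lambda>j y. best_bid m (R \<union> {a} \<times> {..<j}) y"
  have "?P (x 3 0) (sem find_row x)"
    unfolding find_row_def
  proof (rule sem_LFor_induct[where P = ?P], goal_cases)
    case 2
    then show ?case using R by (simp add: best_bid_def)
  next
    case (3 j y)
    have j: "j < n" using 3(1) assms(1,2) by (simp add: env_def)
    have y: "y a = m a" if "a \<notin> {24, 25, 26, 27, 28}" for a
      using 3(2) assms(2) that by auto
    have y25: "y 25 0 = a" using 3(2) assms(3) by simp
    have "env y" using assms(1) y by (subst env_cong[of y m]) auto
    have c: "0 < expr_val (And_e (Not_e (T_e (Var 26)))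
            (And_e (adj_e (Var 25) (Var 26)) (Less_e (Load 8 (Var 26)) (Var 24)))) y \<longleftrightarrow>
          bidding (\<lambda>x. m 6 x \<noteq> 0) (m 7) a j \<and> m 8 j < y 24 0"
      using T_e[OF \<open>env y\<close>, of "Var 26"] adj_e[OF \<open>env y\<close>, of "Var 25" "Var 26"] y y25 3(3) j assms(4-6)
      by (auto simp: bidding_def)
    have R': "R \<union> {a} \<times> {..<Suc j} = insert (a, j) (R \<union> {a} \<times> {..<j})" by auto
    show ?case
    proof (cases "bidding (\<lambda>x. m 6 x \<noteq> 0) (m 7) a j \<and> m 8 j < y 24 0")
      case True
      then show ?thesis
        unfolding R' by (intro best_bid_better[OF 3(4)]) (use c y y25 3(3) in simp_all)
    next
      case False
      then show ?thesis
        unfolding R' by (intro best_bid_keep[OF 3(4)]) (use False c in auto)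
    qed
  qed auto
  moreover have "x 3 0 = n" using assms(1,2) by (simp add: env_def)
  ultimately show ?thesis by simp
qed

lemma sem_find_bid:
  assumes "env m"
  shows "best_bid m UNIV (sem find_bid m)"
proof -
  define m1 where "m1 = set_cell m 24 0 (Suc n)"
  let ?P = "\<lambda>i x. best_bid m ({..<i} \<times> UNIV) x"
  have "?P (m1 3 0)
    (sem (LFor 25 3 (LIf (And_e (Load 6 (Var 25)) (Not_e (Load 7 (Var 25)))) find_row LSkip)) m1)"
  proof (rule sem_LFor_induct[where P = ?P], goal_cases)
    case 2
    then show ?case by (simp add: best_bid_def m1_def)
  next
    case (3 i x)
    have i: "i < n" using 3(1) assms(1) by (simp add: env_def m1_def)
    have x: "x a = m a" if "a \<notin> {24, 25, 26, 27, 28}" for a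
      using 3(2) that by (simp add: m1_def)
    have upd: "best_bid m R (set_cell y 25 0 z) \<longleftrightarrow> best_bid m R y" for R y z
      by (simp add: best_bid_def)
    have weaken: "best_bid m ({..<Suc i} \<times> UNIV) y"
      if "best_bid m R y" and "\<And>b. b < n \<Longrightarrow> m 6 i \<noteq> 0 \<Longrightarrow> m 7 i = 0 \<Longrightarrow> (i, b) \<in> R"
        "{..<i} \<times> UNIV \<subseteq> R" for R y
      using that unfolding best_bid_def by (auto simp: bidding_def less_Suc_eq)
    show ?case
    proof (cases "m 6 i \<noteq> 0 \<and> m 7 i = 0")
      case True
      then have "best_bid m ({..<i} \<times> UNIV \<union> {i} \<times> {..<n}) (sem find_row x)"
        using sem_find_row[OF assms x 3(3) i] 3(4) by simp
      then have "best_bid m ({..<Suc i} \<times> UNIV) (sem find_row x)"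
        by (rule weaken) auto
      then show ?thesis using True x 3(3) by (simp add: upd)
    next
      case False
      have "best_bid m ({..<Suc i} \<times> UNIV) x"
        by (rule weaken[OF 3(4)]) (use False in auto)
      then show ?thesis using False x 3(3) by (auto simp: upd)
    qed
  qed simp
  moreover have "m1 3 0 = n" using assms by (simp add: m1_def env_def)
  ultimately have "best_bid m ({..<n} \<times> UNIV) (sem find_bid m)"
    using assms by (simp add: find_bid_def m1_def env_def)
  then show ?thesis by (auto simp: best_bid_def bidding_def)
qed

lemma sem_release:
  assumes "env m" "x < n"
  shows "sem release m 7 x = (if m 7 x = Suc (m 28 0) then 0 else m 7 x)"
proof -
  let ?P = "\<lambda>i y. \<forall>x. y 7 x = (if x < i \<and> m 7 x = Suc (m 28 0) then 0 else m 7 x)"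
  have "?P (m 3 0) (sem release m)"
    unfolding release_def
  proof (rule sem_LFor_induct[where P = ?P], goal_cases)
    case (3 i y)
    have "y 28 = m 28" using 3(2) by simp
    then show ?case using 3(3,4) by (auto simp: less_Suc_eq)
  qed auto
  then show ?thesis using assms by (simp add: env_def)
qed

text \<open>Progress or stability. The progress case records a bid at price at most
  \<open>n\<close>, which rules that case out once no such bid is left.\<close>

lemma sem_bid_round:
  assumes env: "env m" and inv: "auction (\<lambda>x. m 6 x \<noteq> 0) (m 7) (m 8)"
  defines "m' \<equiv> sem bid_round m"
  shows "auction (\<lambda>x. m 6 x \<noteq> 0) (m' 7) (m' 8) \<and>
    ((\<Sum>b<n. m' 8 b) = Suc (\<Sum>b<n. m 8 b) \<and>
       (\<exists>a b. bidding (\<lambda>x. m 6 x \<noteq> 0) (m 7) a b \<and> m 8 b \<le> n) \<or>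
     m' 7 = m 7 \<and> m' 8 = m 8 \<and> (\<forall>a b. bidding (\<lambda>x. m 6 x \<noteq> 0) (m 7) a b \<longrightarrow> n < m 8 b))"
proof -
  define x where "x = sem find_bid m"
  have x: "x a = m a" if "a \<notin> {24, 25, 26, 27, 28}" for a
    unfolding x_def using that by (intro sem_frame) simp
  have x3: "x 3 0 = n" using x[of 3] env by (simp add: env_def)
  have best: "best_bid m UNIV x" unfolding x_def by (rule sem_find_bid[OF env])
  show ?thesis
  proof (cases "x 24 0 \<le> n")
    case False
    then have "m' = x" using x3 by (simp add: m'_def bid_round_def flip: x_def)
    then show ?thesis using x[of 7] x[of 8] inv best False
      by (fastforce simp: best_bid_def)
  next
    case True
    then have m': "m' = sem place_bid x" using x3 by (simp add: m'_def bid_round_def flip: x_def)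
    have bid: "bidding (\<lambda>x. m 6 x \<noteq> 0) (m 7) (x 27 0) (x 28 0)" "m 8 (x 28 0) = x 24 0"
      "\<And>a b. bidding (\<lambda>x. m 6 x \<noteq> 0) (m 7) a b \<Longrightarrow> m 8 (x 28 0) \<le> m 8 b"
      using best True by (auto simp: best_bid_def)
    define y where "y = sem release x"
    have y: "y a = x a" if "a \<notin> {7, 29}" for a
      unfolding y_def using that by (intro sem_frame) simp
    have "env x" using env x by (subst env_cong[of x m]) auto
    have y7: "y 7 z = (if m 7 z = Suc (x 28 0) then 0 else m 7 z)" if "z < n" for z
      unfolding y_def using sem_release[OF \<open>env x\<close> that] x[of 7] by simp
    have m'7: "m' 7 z = (if z = x 27 0 then Suc (x 28 0) else if m 7 z = Suc (x 28 0) then 0 else m 7 z)"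
      if "z < n" for z
      using y7[OF that] y unfolding m' place_bid_def by (simp flip: y_def)
    have m'8: "m' 8 = (m 8)(x 28 0 := Suc (m 8 (x 28 0)))"
      using y x[of 8] unfolding m' place_bid_def by (simp flip: y_def)
    have "x 28 0 < n" using bid(1) by (simp add: bidding_def)
    then have "(\<Sum>b<n. m' 8 b) = Suc (\<Sum>b<n. m 8 b)"
      unfolding m'8 by (simp add: sum.remove[of "{..<n}" "x 28 0"])
    moreover have "auction (\<lambda>x. m 6 x \<noteq> 0) (m' 7) (m' 8)"
      by (rule auction_bid[OF inv bid(1)]) (use bid True m'7 m'8 in auto)
    moreover have "m 8 (x 28 0) \<le> n" using bid(2) True by simp
    ultimately show ?thesis using bid(1) by blast
  qed
qed

text \<open>The sum of the prices is a potential: until the auction is final it is at least the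
  number of rounds, yet it never exceeds \<open>n * (n + 1)\<close>, which is less than
  \<open>L\<close>. Later rounds change nothing.\<close>

lemma sem_bid_rounds:
  assumes env: "env m" and "\<And>x. x < n \<Longrightarrow> m 7 x = 0 \<and> m 8 x = 0"
  defines "m' \<equiv> sem (LFor 23 1 bid_round) m"
  shows "auction (\<lambda>x. m 6 x \<noteq> 0) (m' 7) (m' 8)"
    and "bidding (\<lambda>x. m 6 x \<noteq> 0) (m' 7) a b \<Longrightarrow> n < m' 8 b"
proof -
  let ?P = "\<lambda>i x. auction (\<lambda>x. m 6 x \<noteq> 0) (x 7) (x 8) \<and> (i \<le> (\<Sum>b<n. x 8 b) \<or>
    (\<forall>a b. bidding (\<lambda>x. m 6 x \<noteq> 0) (x 7) a b \<longrightarrow> n < x 8 b))"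
  have *: "?P (m 1 0) m'"
    unfolding m'_def
  proof (rule sem_LFor_induct[where P = ?P], goal_cases)
    case 2
    then show ?case using assms(2) by (simp add: auction_def)
  next
    case (3 i x)
    have "env x" using env 3(2) by (subst env_cong[of x m]) auto
    moreover have "x 6 = m 6" using 3(2) by simp
    ultimately have "auction (\<lambda>x. m 6 x \<noteq> 0) (sem bid_round x 7) (sem bid_round x 8)"
      and "(\<Sum>b<n. sem bid_round x 8 b) = Suc (\<Sum>b<n. x 8 b) \<and>
             (\<exists>a b. bidding (\<lambda>x. m 6 x \<noteq> 0) (x 7) a b \<and> x 8 b \<le> n) \<or>
         sem bid_round x 7 = x 7 \<and> sem bid_round x 8 = x 8 \<and>
             (\<forall>a b. bidding (\<lambda>x. m 6 x \<noteq> 0) (x 7) a b \<longrightarrow> n < x 8 b)"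
      using sem_bid_round[of x] 3(4) by auto
    then show ?case using 3(4) by (auto simp: not_less[symmetric])
  qed simp
  then show inv: "auction (\<lambda>x. m 6 x \<noteq> 0) (m' 7) (m' 8)" by blast
  have "(\<Sum>b<n. m' 8 b) \<le> (\<Sum>b<n. Suc n)"
    using auctionD(4)[OF inv] by (intro sum_mono) auto
  also have "\<dots> < L" using L by simp
  finally show "bidding (\<lambda>x. m 6 x \<noteq> 0) (m' 7) a b \<Longrightarrow> n < m' 8 b"
    using * env by (auto simp: env_def)
qed

lemma sem_count_cover:
  assumes "env m"
  shows "sem count_cover m 30 0 = card {x. x < n \<and> (T x \<and> \<not> m 6 x \<noteq> 0 \<or> m 7 x \<noteq> 0)}"
proof -
  define m1 where "m1 = set_cell m 30 0 0"
  let ?P = "\<lambda>i x. x 30 0 = card {y. y < i \<and> (T y \<and> \<not> m 6 y \<noteq> 0 \<or> m 7 y \<noteq> 0)}"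
  have "?P (m1 3 0)
    (sem (LFor 31 3 (LIf (Add (And_e (T_e (Var 31)) (Not_e (Load 6 (Var 31)))) (Load 7 (Var 31)))
       (LSet 30 (Add (Var 30) (Const 1))) LSkip)) m1)"
  proof (rule sem_LFor_induct[where P = ?P], goal_cases)
    case (3 i x)
    have i: "i < n" using 3(1) assms(1) by (simp add: env_def m1_def)
    have x: "x a = m a" if "a \<notin> {30, 31}" for a using 3(2) that by (simp add: m1_def)
    have "env x" using assms(1) x by (subst env_cong[of x m]) auto
    then have c: "0 < expr_val (Add (And_e (T_e (Var 31)) (Not_e (Load 6 (Var 31)))) (Load 7 (Var 31))) x
        \<longleftrightarrow> T i \<and> \<not> m 6 i \<noteq> 0 \<or> m 7 i \<noteq> 0"
      using T_e[of x "Var 31"] 3(3) i x by simp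
    have "{y. y < Suc i \<and> (T y \<and> \<not> m 6 y \<noteq> 0 \<or> m 7 y \<noteq> 0)} =
      (if T i \<and> \<not> m 6 i \<noteq> 0 \<or> m 7 i \<noteq> 0 then insert i else id)
        {y. y < i \<and> (T y \<and> \<not> m 6 y \<noteq> 0 \<or> m 7 y \<noteq> 0)}"
      by (auto simp: less_Suc_eq)
    then show ?case using c 3(3,4) by simp
  qed (auto simp: m1_def)
  moreover have "m1 3 0 = n" using assms by (simp add: m1_def env_def)
  ultimately show ?thesis by (simp add: count_cover_def m1_def)
qed

definition good_pairs :: "nat \<Rightarrow> (nat \<Rightarrow> nat) \<Rightarrow> (nat \<Rightarrow> nat) \<Rightarrow> bool" where
  "good_pairs r v u \<longleftrightarrow> (\<exists>I S. greedy v u r I \<and> cover S \<and>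
     {x. x < n \<and> T x \<and> \<not> I x} \<subseteq> S \<and> card S \<le> k)"

lemma sem_test_pairs:
  assumes env: "env m"
  shows "sem (test_pairs r) m 2 0 \<noteq> 0 \<longleftrightarrow>
    m 2 0 \<noteq> 0 \<or> good_pairs r (\<lambda>j. m (100 + 2 * j) 0) (\<lambda>j. m (101 + 2 * j) 0)"
proof -
  let ?v = "\<lambda>j. m (100 + 2 * j) 0" and ?u = "\<lambda>j. m (101 + 2 * j) 0"
  define m1 where "m1 = sem clear_arrays m"
  define m2 where "m2 = sem (build_greedy r) m1"
  define m3 where "m3 = sem (LFor 23 1 bid_round) m2"
  define m4 where "m4 = sem count_cover m3"
  have m1: "m1 a = m a" if "a \<notin> {6, 7, 8, 20}" for a
    unfolding m1_def using that by (intro sem_frame) simp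
  have m2: "m2 a = m1 a" if "a \<notin> {6, 20, 21, 22}" for a
    unfolding m2_def using that by (intro sem_frame) simp
  have m3: "m3 a = m2 a" if "a \<notin> {7, 8, 23, 24, 25, 26, 27, 28, 29}" for a
    unfolding m3_def using that by (intro sem_frame) simp
  have m4: "m4 a = m3 a" if "a \<notin> {30, 31}" for a
    unfolding m4_def using that by (intro sem_frame) simp
  have env1: "env m1" using env m1 by (subst env_cong[of m1 m]) auto
  have env2: "env m2" using env1 m2 by (subst env_cong[of m2 m1]) auto
  have env3: "env m3" using env2 m3 by (subst env_cong[of m3 m2]) auto
  have env4: "env m4" using env3 m4 by (subst env_cong[of m4 m3]) auto
  define I where "I = (\<lambda>x. m2 6 x \<noteq> 0)"
  have "greedy (\<lambda>j. m1 (100 + 2 * j) 0) (\<lambda>j. m1 (101 + 2 * j) 0) r I"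
    unfolding I_def m2_def using sem_clear_arrays[OF env]
    by (intro sem_build_greedy[OF env1]) (simp add: m1_def)
  then have I: "greedy ?v ?u r I" using m1 by simp
  have "m2 7 x = 0 \<and> m2 8 x = 0" if "x < n" for x
    using sem_clear_arrays[OF env that] m2[of 7] m2[of 8] by (simp add: m1_def)
  note rounds = sem_bid_rounds[OF env2 this, folded m3_def I_def]
  have 6: "m3 6 = m2 6" using m3[of 6] by simp
  have "m4 30 0 = card {x. x < n \<and> (T x \<and> \<not> I x \<or> m3 7 x \<noteq> 0)}"
    unfolding m4_def sem_count_cover[OF env3] I_def 6 ..
  then have "m4 30 0 \<le> k \<longleftrightarrow>
      (\<exists>S. cover S \<and> {x. x < n \<and> T x \<and> \<not> I x} \<subseteq> S \<and> card S \<le> k)"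
    using auction_final[OF greedy_independent[OF I] rounds] by simp
  also have "\<dots> \<longleftrightarrow> good_pairs r ?v ?u"
  proof -
    \<comment> \<open>The advice determines the greedy set below \<open>n\<close>, so the
      \<open>I\<close> quantified in \<open>good_pairs\<close> can be taken to be the one
      built.\<close>
    have "{x. x < n \<and> T x \<and> \<not> J x} = {x. x < n \<and> T x \<and> \<not> I x}" if "greedy ?v ?u r J" for J
      using greedy_unique[OF I that] by auto
    note same = this
    show ?thesis
      unfolding good_pairs_def
    proof (intro iffI; elim exE conjE)
      fix S assume "cover S" "{x. x < n \<and> T x \<and> \<not> I x} \<subseteq> S" "card S \<le> k"
      then show "\<exists>I S. greedy ?v ?u r I \<and> cover S \<and> {x. x < n \<and> T x \<and> \<not> I x} \<subseteq> S \<and> card S \<le> k"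
        using I by (intro exI[of _ I] exI[of _ S] conjI)
    next
      fix J S assume "greedy ?v ?u r J" "cover S" "{x. x < n \<and> T x \<and> \<not> J x} \<subseteq> S" "card S \<le> k"
      then show "\<exists>S. cover S \<and> {x. x < n \<and> T x \<and> \<not> I x} \<subseteq> S \<and> card S \<le> k"
        unfolding same[OF \<open>greedy ?v ?u r J\<close>] by (intro exI[of _ S] conjI)
    qed
  qed
  finally have main: "m4 30 0 \<le> k \<longleftrightarrow> good_pairs r ?v ?u" .
  have "m4 2 0 = m 2 0" using m1[of 2] m2[of 2] m3[of 2] m4[of 2] by simp
  moreover have "m4 5 0 = k" using env4 by (simp add: env_def)
  moreover have "sem (test_pairs r) m = (if m4 5 0 < m4 30 0 then m4 else set_cell m4 2 0 1)"
  proof -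
    have "sem (test_pairs r) m = sem (LIf (Less_e (Var 5) (Var 30)) LSkip (LSet 2 (Const 1))) m4"
      unfolding test_pairs_def m4_def m3_def m2_def m1_def by (simp only: sem.simps(3))
    then show ?thesis by simp
  qed
  ultimately show ?thesis using main by auto
qed

text \<open>A loop acts as a bounded existential quantifier on the answer cell. Array 2 is exempt
  from the writes of \<open>c\<close> that must avoid the input, since \<open>c\<close> reports
  there.\<close>

lemma sem_LFor_any:
  assumes "counters_ok (LFor w 1 c)" "{0, 1, 2, 3, 4, 5} \<inter> insert w (writes c - {2}) = {}"
    and env: "env m" and out: "\<And>x i. env x \<Longrightarrow> (\<And>a. a \<notin> insert w (writes c) \<Longrightarrow> x a = m a) \<Longrightarrow>
      x w 0 = i \<Longrightarrow> sem c x 2 0 \<noteq> 0 \<longleftrightarrow> x 2 0 \<noteq> 0 \<or> Q i"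
  shows "sem (LFor w 1 c) m 2 0 \<noteq> 0 \<longleftrightarrow> m 2 0 \<noteq> 0 \<or> (\<exists>i<L. Q i)"
proof -
  let ?P = "\<lambda>i x. x 2 0 \<noteq> 0 \<longleftrightarrow> m 2 0 \<noteq> 0 \<or> (\<exists>j<i. Q j)"
  have "?P (m 1 0) (sem (LFor w 1 c) m)"
  proof (rule sem_LFor_induct[where P = ?P], goal_cases)
    case (3 i x)
    have "env x" using env assms(2) 3(2) by (subst env_cong[of x m]) auto
    then have "sem c x 2 0 \<noteq> 0 \<longleftrightarrow> x 2 0 \<noteq> 0 \<or> Q i" by (rule out[OF _ 3(2,3)])
    then show ?case using 3(4) assms(2) by (auto simp: less_Suc_eq)
  qed (use assms in auto)
  then show ?thesis using env by (simp add: env_def)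
qed

end

section \<open>Enumeration of the advice\<close>

lemma writes_all_pairs:
  "writes (all_pairs j c) = writes c \<union> {100 + 2 * i | i. i < j} \<union> {101 + 2 * i | i. i < j}"
  by (induction j) (auto simp: less_Suc_eq)

lemma all_pairs_ok:
  assumes "counters_ok c" "writes c \<subseteq> {..<100}"
  shows "counters_ok (all_pairs j c)" and "bounds (all_pairs j c) \<subseteq> insert 1 (bounds c)"
proof -
  have "100 + 2 * j \<notin> writes (all_pairs j c)" "101 + 2 * j \<notin> writes (all_pairs j c)" for j
    using assms(2) by (auto simp: writes_all_pairs) presburger+
  then show "counters_ok (all_pairs j c)"
    using assms(1) by (induction j) auto
  show "bounds (all_pairs j c) \<subseteq> insert 1 (bounds c)"
    by (induction j) auto
qed

context svc_program
begin

text \<open>Inner loops run with the counters of the outer ones fixed, hence the generalisation over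
  the memory: pairs below \<open>j\<close> are quantified, pairs from \<open>j\<close> on are read
  from their arrays.\<close>

lemma sem_all_pairs:
  assumes "env m"
  shows "sem (all_pairs j (test_pairs r)) m 2 0 \<noteq> 0 \<longleftrightarrow> m 2 0 \<noteq> 0 \<or>
    (\<exists>v u. (\<forall>i<j. v i < L \<and> u i < L) \<and>
       (\<forall>i\<ge>j. v i = m (100 + 2 * i) 0 \<and> u i = m (101 + 2 * i) 0) \<and> good_pairs r v u)"
  using assms
proof (induction j arbitrary: m)
  case 0
  have "(\<forall>i. v i = m (100 + 2 * i) 0 \<and> u i = m (101 + 2 * i) 0) \<longleftrightarrow>
      v = (\<lambda>j. m (100 + 2 * j) 0) \<and> u = (\<lambda>j. m (101 + 2 * j) 0)" for v u
    by (auto simp: fun_eq_iff)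
  then show ?case using sem_test_pairs[OF 0] by simp
next
  case (Suc j)
  let ?c = "all_pairs j (test_pairs r)"
  define Q where "Q = (\<lambda>a b. \<exists>v u. (\<forall>i<j. v i < L \<and> u i < L) \<and> v j = a \<and> u j = b \<and>
      (\<forall>i>j. v i = m (100 + 2 * i) 0 \<and> u i = m (101 + 2 * i) 0) \<and> good_pairs r v u)"
  have ok: "counters_ok (all_pairs i (test_pairs r))" for i
    by (intro all_pairs_ok) auto
  have fresh: "100 + 2 * i \<notin> writes ?c" "101 + 2 * i \<notin> writes ?c" if "j \<le> i" for i
    using that by (auto simp: writes_all_pairs)
  have disj: "{0, 1, 2, 3, 4, 5} \<inter> insert w (writes ?c - {2}) = {}" if "100 \<le> w" for w
    using that by (auto simp: writes_all_pairs)
  have inner: "sem (LFor (101 + 2 * j) 1 ?c) x 2 0 \<noteq> 0 \<longleftrightarrow> x 2 0 \<noteq> 0 \<or> (\<exists>b<L. Q a b)"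
    if x: "env x" "\<And>d. d \<notin> insert (100 + 2 * j) (writes (LFor (101 + 2 * j) 1 ?c)) \<Longrightarrow> x d = m d"
      "x (100 + 2 * j) 0 = a" for x a
  proof (rule sem_LFor_any[OF _ disj x(1)])
    show "counters_ok (LFor (101 + 2 * j) 1 ?c)" using ok fresh by simp
    fix y b
    assume y: "env y" "\<And>d. d \<notin> insert (101 + 2 * j) (writes ?c) \<Longrightarrow> y d = x d" "y (101 + 2 * j) 0 = b"
    have "y (100 + 2 * j) 0 = a" using y(2)[of "100 + 2 * j"] fresh[of j] x(3) by (simp; presburger)
    moreover have "y (100 + 2 * i) = m (100 + 2 * i) \<and> y (101 + 2 * i) = m (101 + 2 * i)"
      if "i > j" for i
      using y(2) x(2) fresh[of i] that by (auto; presburger)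
    moreover have "(\<forall>i\<ge>j. R i) \<longleftrightarrow> R j \<and> (\<forall>i>j. R i)" for R
      by (metis le_less)
    ultimately show "sem ?c y 2 0 \<noteq> 0 \<longleftrightarrow> y 2 0 \<noteq> 0 \<or> Q a b"
      unfolding Suc.IH[OF y(1)] Q_def using y(3) by simp
  qed simp
  have "sem (all_pairs (Suc j) (test_pairs r)) m 2 0 \<noteq> 0 \<longleftrightarrow> m 2 0 \<noteq> 0 \<or> (\<exists>a<L. \<exists>b<L. Q a b)"
    unfolding all_pairs.simps
  proof (rule sem_LFor_any[OF _ _ Suc.prems])
    show "counters_ok (LFor (100 + 2 * j) 1 (LFor (101 + 2 * j) 1 ?c))"
      using ok[of "Suc j"] by simp
    show "{0, 1, 2, 3, 4, 5} \<inter> insert (100 + 2 * j) (writes (LFor (101 + 2 * j) 1 ?c) - {2}) = {}"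
      using disj[of "101 + 2 * j"] by auto
  qed (rule inner)
  also have "(\<exists>a<L. \<exists>b<L. Q a b) \<longleftrightarrow> (\<exists>v u. (\<forall>i<Suc j. v i < L \<and> u i < L) \<and>
       (\<forall>i\<ge>Suc j. v i = m (100 + 2 * i) 0 \<and> u i = m (101 + 2 * i) 0) \<and> good_pairs r v u)"
    unfolding Q_def by (simp add: less_Suc_eq Suc_le_eq all_conj_distrib imp_disjL) blast
  finally show ?case .
qed

end

section \<open>Instances and their encodings\<close>

lemma not_H_free_sP2:
  fixes G :: "nat pair_pre_digraph" and s :: nat
  defines "V \<equiv> {..<s} \<times> (UNIV :: bool set)"
  assumes G: "pair_graph G" and T: "T \<subseteq> pverts G"
    and inj: "inj_on h V" and hT: "h ` V \<subseteq> T"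
    and adj: "\<And>p q. p \<in> V \<Longrightarrow> q \<in> V \<Longrightarrow> (h p, h q) \<in> parcs G \<longleftrightarrow> fst p = fst q \<and> snd p \<noteq> snd q"
  shows "\<not> H_free (with_proj (sP2 s)) (with_proj G \<restriction> T)"
proof -
  interpret pair_graph G by fact
  \<comment> \<open>An isomorphism has to lead from the induced subgraph to \<open>sP2 s\<close>,
    hence the inverse of the embedding.\<close>
  define g where "g = the_inv_into V h"
  have gh: "g (h p) = p" if "p \<in> V" for p
    unfolding g_def using inj that by (rule the_inv_into_f_f)
  define F where "F = (with_proj G \<restriction> T) \<restriction> (h ` V)"
  have GT: "wf_digraph (with_proj G \<restriction> T)" by (rule wellformed_induce_subgraph)
  then have ind: "induced_subgraph F (with_proj G \<restriction> T)"
    unfolding F_def using hT by (intro wf_digraph.induced_induce) auto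
  have wfF: "wf_digraph F" unfolding F_def by (rule wf_digraph.wellformed_induce_subgraph[OF GT])
  have arcsF: "arcs F = {(h p, h q) | p q. p \<in> V \<and> q \<in> V \<and> fst p = fst q \<and> snd p \<noteq> snd q}"
    using adj hT unfolding F_def by fastforce
  define f where "f = \<lparr> iso_verts = g, iso_arcs = map_prod g g, iso_head = snd, iso_tail = fst \<rparr>"
  have vertsF: "verts F = h ` V" by (simp add: F_def)
  have inj_g: "inj_on g (h ` V)" using gh by (auto intro!: inj_onI)
  have "pre_digraph.digraph_isomorphism F f"
    unfolding pre_digraph.digraph_isomorphism_def
  proof (intro conjI ballI wfF)
    show "inj_on (iso_verts f) (verts F)" using inj_g by (simp add: f_def vertsF)
    have "inj_on (iso_arcs f) (h ` V \<times> h ` V)"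
      unfolding f_def by (simp, rule map_prod_inj_on[OF inj_g inj_g])
    then show "inj_on (iso_arcs f) (arcs F)"
      by (rule inj_on_subset) (auto simp: arcsF)
  qed (simp_all add: f_def F_def)
  moreover have "app_iso f F = with_proj (sP2 s)"
  proof (rule pre_digraph.equality)
    have "g ` h ` V = V" using gh by force
    then show "verts (app_iso f F) = verts (with_proj (sP2 s))"
      by (simp add: f_def vertsF sP2_def V_def)
    have "map_prod g g ` arcs F = {(p, q). p \<in> V \<and> q \<in> V \<and> fst p = fst q \<and> snd p \<noteq> snd q}"
    proof (intro equalityI subsetI)
      fix e assume "e \<in> map_prod g g ` arcs F"
      then show "e \<in> {(p, q). p \<in> V \<and> q \<in> V \<and> fst p = fst q \<and> snd p \<noteq> snd q}"
        using gh by (auto simp: arcsF)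
    next
      fix e assume "e \<in> {(p, q). p \<in> V \<and> q \<in> V \<and> fst p = fst q \<and> snd p \<noteq> snd q}"
      then obtain p q where e: "e = (p, q)" "p \<in> V" "q \<in> V" "fst p = fst q" "snd p \<noteq> snd q" by auto
      then have "(h p, h q) \<in> arcs F" unfolding arcsF by blast
      moreover have "e = map_prod g g (h p, h q)" using e gh by simp
      ultimately show "e \<in> map_prod g g ` arcs F" by (rule rev_image_eqI)
    qed
    also have "\<dots> = {((i, b), (i, \<not> b)) |i b. i < s}" by (auto simp: V_def)
    finally show "arcs (app_iso f F) = arcs (with_proj (sP2 s))" by (simp add: f_def sP2_def)
  qed (simp_all add: f_def)
  ultimately have "digraph_iso F (with_proj (sP2 s))" unfolding digraph_iso_def by metis
  then show ?thesis using ind unfolding H_free_def by blast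
qed

section \<open>Layout of the input word\<close>

lemma nth_concat_equal_length:
  assumes "\<forall>xs\<in>set xss. length xs = n" "x < length xss" "y < n"
  shows "concat xss ! (x * n + y) = xss ! x ! y"
  using assms
proof (induction xss arbitrary: x)
  case (Cons xs xss)
  then show ?case by (cases x) (auto simp: nth_append add.assoc)
qed simp

lemma length_concat_equal_length:
  "\<forall>xs\<in>set xss. length xs = n \<Longrightarrow> length (concat xss) = length xss * n"
  by (induction xss) auto

lemma svc_word_facts:
  fixes G :: "nat pair_pre_digraph" and vs T k
  defines "n \<equiv> length vs" and "w \<equiv> svc_word vs (G, T, k)"
  shows length_svc_word: "length w = 2 * n + 1 + n * n + length (nat_bits k)"
    and svc_word_unary: "i < n \<Longrightarrow> w ! i" "\<not> w ! n"
    and svc_word_T: "x < n \<Longrightarrow> w ! (n + 1 + x) \<longleftrightarrow> vs ! x \<in> T"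
    and svc_word_adj: "x < n \<Longrightarrow> y < n \<Longrightarrow>
      w ! (2 * n + 1 + x * n + y) \<longleftrightarrow> (vs ! x, vs ! y) \<in> parcs G"
    and svc_word_k: "w ! (2 * n + 1 + n * n + i) = nat_bits k ! i"
proof -
  define M where "M = map (\<lambda>u. map (\<lambda>v. (u, v) \<in> parcs G) vs) vs"
  have M: "\<forall>xs\<in>set M. length xs = n" "length M = n" by (auto simp: M_def n_def)
  have w: "w = replicate n True @ [False] @ map (\<lambda>v. v \<in> T) vs @ concat M @ nat_bits k"
    by (simp add: w_def svc_word_def M_def n_def)
  have lc: "length (concat M) = n * n" using length_concat_equal_length[OF M(1)] M(2) by simp
  show "length w = 2 * n + 1 + n * n + length (nat_bits k)"
    unfolding w using lc by (simp add: n_def)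
  show "i < n \<Longrightarrow> w ! i" "\<not> w ! n" unfolding w by (simp_all add: nth_append)
  show "w ! (n + 1 + x) \<longleftrightarrow> vs ! x \<in> T" if "x < n"
    using that unfolding w by (simp add: nth_append n_def)
  show "w ! (2 * n + 1 + x * n + y) \<longleftrightarrow> (vs ! x, vs ! y) \<in> parcs G" if "x < n" "y < n"
  proof -
    have "Suc x * n \<le> n * n" using that(1) by (intro mult_right_mono) auto
    then have "x * n + y < n * n" using that(2) by simp
    moreover have "2 * n + 1 + x * n + y = length (replicate n True @ [False] @ map (\<lambda>v. v \<in> T) vs) + (x * n + y)"
      by (simp add: n_def)
    moreover have "w = (replicate n True @ [False] @ map (\<lambda>v. v \<in> T) vs) @ concat M @ nat_bits k"
      by (simp add: w)
    ultimately have "w ! (2 * n + 1 + x * n + y) = concat M ! (x * n + y)"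
      using lc by (simp add: nth_append_length_plus nth_append del: append_assoc)
    also have "\<dots> = M ! x ! y" by (rule nth_concat_equal_length) (use M that in auto)
    finally show ?thesis using that by (simp add: M_def n_def)
  qed
  show "w ! (2 * n + 1 + n * n + i) = nat_bits k ! i"
  proof -
    have "w = (replicate n True @ [False] @ map (\<lambda>v. v \<in> T) vs @ concat M) @ nat_bits k"
      by (simp add: w)
    moreover have "2 * n + 1 + n * n + i = length (replicate n True @ [False] @ map (\<lambda>v. v \<in> T) vs @ concat M) + i"
      using lc by (simp add: n_def)
    ultimately show ?thesis by (metis nth_append_length_plus)
  qed
qed

lemma sem_parse:
  fixes G :: "nat pair_pre_digraph" and vs T k
  defines "n \<equiv> length vs" and "w \<equiv> svc_word vs (G, T, k)"
  defines "m \<equiv> sem parse (init_memory w)"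
  shows "a \<notin> {3, 4, 5, 10, 11, 12} \<Longrightarrow> m a = init_memory w a"
    and "m 3 0 = n" "i \<le> n \<Longrightarrow> m 4 i = 2 * n + 1 + i * n" "m 5 0 = k"
proof -
  define m0 where "m0 = init_memory w"
  have m0: "m0 0 i = of_bool (i < length w \<and> w ! i)" "m0 1 0 = length w" "1 < a \<Longrightarrow> m0 a i = 0" for a i
    by (auto simp: m0_def init_memory_def)
  define m1 where "m1 = sem count_vertices m0"
  define m2 where "m2 = sem compute_rows m1"
  have m: "m = sem read_bound m2"
    by (simp add: m_def m0_def m1_def m2_def parse_def)
  have f1: "m1 a = m0 a" if "a \<notin> {3, 10, 11}" for a
    unfolding m1_def using that by (intro sem_frame) (auto simp: count_vertices_def)
  have f2: "m2 a = m1 a" if "a \<notin> {4, 10}" for a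
    unfolding m2_def using that by (intro sem_frame) (auto simp: compute_rows_def)
  have f3: "m a = m2 a" if "a \<notin> {5, 10, 12}" for a
    unfolding m using that by (intro sem_frame) (auto simp: read_bound_def)
  show "m a = init_memory w a" if "a \<notin> {3, 4, 5, 10, 11, 12}"
    using f1[of a] f2[of a] f3[of a] that by (simp add: m0_def)
  note len = length_svc_word[of vs G T k, folded n_def w_def]
  have nw: "n < length w" using len by simp
  have n1: "m1 3 0 = n"
    unfolding m1_def
  proof (rule sem_count_vertices[where L = "length w"])
    show "m0 0 i \<noteq> 0" if "i < n" for i
      using svc_word_unary(1)[of i vs G T k] that nw by (simp add: m0 n_def w_def)
    show "m0 0 n = 0"
      using svc_word_unary(2)[of vs G T k] by (simp add: m0 n_def w_def)
  qed (use m0 nw in auto)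
  then show "m 3 0 = n" using f2[of 3] f3[of 3] by simp
  have rows: "m2 4 i = 2 * n + 1 + i * n" if "i \<le> n" for i
    unfolding m2_def by (rule sem_compute_rows[where L = "length w"]) (use f1 m0 n1 nw that in auto)
  then show "i \<le> n \<Longrightarrow> m 4 i = 2 * n + 1 + i * n" using f3[of 4] by simp
  define off where "off = 2 * n + 1 + n * n"
  have "m 5 0 = (\<Sum>i<length w - off. of_bool (off + i < length w \<and> w ! (off + i)) * 2 ^ i)"
    unfolding m
  proof (rule sem_read_bound)
    show "m2 4 (m2 3 0) = off" using rows[of n] n1 f2[of 3] by (simp add: off_def)
  qed (use f1 f2 m0 in auto)
  also have "\<dots> = (\<Sum>i<length (nat_bits k). of_bool (nat_bits k ! i) * 2 ^ i)"
    using len svc_word_k[of vs G T k, folded n_def w_def]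
    by (intro sum.cong) (auto simp: off_def)
  also have "\<dots> = k" by (rule sum_nat_bits)
  finally show "m 5 0 = k" .
qed

section \<open>Correctness and running time of the whole program\<close>

definition svc_lprog :: "nat \<Rightarrow> lprog" where
  "svc_lprog r = parse ;; all_pairs r (test_pairs r)"

lemma svc_lprog_correct:
  fixes s :: nat
  assumes enc: "svc_encodes (G, T, k) w" and G: "pair_graph G" and T: "T \<subseteq> pverts G"
    and free: "H_free (with_proj (sP2 s)) (with_proj G \<restriction> T)"
  shows "accepting (sem (svc_lprog (s - 1)) (init_memory w)) \<longleftrightarrow> svc_yes (G, T, k)"
proof -
  interpret pair_graph G by fact
  obtain vs where vs: "distinct vs" "set vs = pverts G" "w = svc_word vs (G, T, k)"
    using enc by (auto simp: svc_encodes_def)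
  define n where "n = length vs"
  define m where "m = sem parse (init_memory w)"
  define L where "L = length w"
  define B where "B = (\<lambda>x. x < n \<and> vs ! x \<in> T)"
  \<comment> \<open>Taking the lookup itself as \<open>A\<close> makes the adjacency clause of
    \<open>env\<close> hold by definition; below \<open>n\<close> it is tied to
    \<open>parcs G\<close>.\<close>
  define A where "A = (\<lambda>x y. m 0 (m 4 x + y) \<noteq> 0)"
  note par = sem_parse[where vs = vs and G = G and T = T and k = k, folded n_def, folded vs(3), folded m_def]
  note wf = svc_word_facts[where vs = vs and G = G and T = T and k = k, folded n_def, folded vs(3)]
  have Leq: "L = 2 * n + 1 + n * n + length (nat_bits k)" using wf(1) by (simp add: L_def)
  have bits: "0 < m 0 i \<longleftrightarrow> i < L \<and> w ! i" for i
    using par(1)[of 0] by (simp add: init_memory_def L_def)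
  have mem: "vs ! x \<in> pverts G" if "x < n" for x
    using nth_mem[of x vs] that vs(2) by (simp add: n_def)
  have A: "A x y \<longleftrightarrow> (vs ! x, vs ! y) \<in> parcs G" if "x < n" "y < n" for x y
  proof -
    have "Suc x * n \<le> n * n" using that(1) by (intro mult_right_mono) auto
    then have "x * n + y < n * n" using that(2) by simp
    then show ?thesis using par(3)[of x] wf(5)[OF that] that by (simp add: A_def bits Leq)
  qed
  have sym: "(v, u) \<in> parcs G" if "(u, v) \<in> parcs G" for u v
    using that pair_sym_arcs by (auto simp: symmetric_def dest: symD)
  have irrefl: "(u, u) \<notin> parcs G" for u using pair_no_loops by fastforce
  interpret svc_program n B A L k
  proof
    show "x < n \<Longrightarrow> y < n \<Longrightarrow> A x y \<Longrightarrow> A y x" for x y using A sym by blast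
    show "x < n \<Longrightarrow> \<not> A x x" for x using A irrefl by blast
    show "n * n + 2 * n + 1 \<le> L" using Leq by simp
  qed
  have env: "env m"
    unfolding env_def
  proof (intro conjI allI impI)
    show "m 1 0 = L" using par(1)[of 1] by (simp add: init_memory_def L_def)
    show "m 3 0 = n" "m 5 0 = k" using par by auto
    show "m 0 (n + 1 + x) \<noteq> 0 \<longleftrightarrow> B x" if "x < n" for x
      using wf(4)[OF that] that by (simp add: bits B_def Leq)
  qed (simp add: A_def)
  \<comment> \<open>The answer starts as "no", and the advice arrays beyond the loops hold the 0
    that \<open>cover_iff_greedy\<close> uses for padding.\<close>
  have zero: "m a i = 0" if "a = 2 \<or> 100 \<le> a" for a i
    using par(1)[of a] that by (auto simp: init_memory_def)
  have free': "\<not> induced_matching v u s" for v u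
  proof
    assume mat: "induced_matching v u s"
    define h where "h = (\<lambda>(j, b). if b then v j else u j)"
    have M1: "v j < n" "u j < n" "B (v j)" "B (u j)" "A (v j) (u j)" if "j < s" for j
      using mat that unfolding induced_matching_def by blast+
    have M2: "v i \<noteq> v j" "u i \<noteq> u j" "v i \<noteq> u j" "\<not> A (v i) (v j)" "\<not> A (u i) (u j)"
      "\<not> A (v i) (u j)" if "i < s" "j < s" "i \<noteq> j" for i j
      using mat that unfolding induced_matching_def by blast+
    have M3: "\<not> A (u i) (v j)" if "i < s" "j < s" "i \<noteq> j" for i j
      using A_sym[of "u i" "v j"] M1[OF that(1)] M1[OF that(2)] M2(6)[of j i] that by blast
    have M4: "A (u j) (v j)" "v j \<noteq> u j" if "j < s" for j
      using A_sym[of "v j" "u j"] A_irrefl[of "v j"] M1[OF that] by auto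
    have hn: "h p < n" "B (h p)" if "p \<in> {..<s} \<times> UNIV" for p
      using that M1 by (auto simp: h_def)
    have hA: "A (h p) (h q) \<longleftrightarrow> fst p = fst q \<and> snd p \<noteq> snd q"
      if "p \<in> {..<s} \<times> UNIV" "q \<in> {..<s} \<times> UNIV" for p q
    proof -
      obtain i b where p: "p = (i, b)" by (cases p)
      obtain j c where q: "q = (j, c)" by (cases q)
      show ?thesis
      proof (cases "i = j")
        case True
        then show ?thesis
          using that p q M1(5)[of i] M4(1)[of i] A_irrefl[OF M1(1)[of i]] A_irrefl[OF M1(2)[of i]]
          by (cases b; cases c) (auto simp: h_def)
      next
        case False
        then show ?thesis
          using that p q M2[of i j] M3[of i j] by (cases b; cases c) (auto simp: h_def)
      qed
    qed
    have "inj_on h ({..<s} \<times> UNIV)"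
    proof (rule inj_onI)
      fix p q assume pq: "p \<in> {..<s} \<times> UNIV" "q \<in> {..<s} \<times> UNIV" "h p = h q"
      obtain i b where p: "p = (i, b)" by (cases p)
      obtain j c where q: "q = (j, c)" by (cases q)
      have i: "i < s" "j < s" using pq p q by auto
      have "i = j"
      proof (rule ccontr)
        assume ne: "i \<noteq> j"
        show False
          using pq(3) p q M2(1,2,3)[OF i ne] M2(3)[OF i(2,1)] ne
          by (cases b; cases c) (auto simp: h_def)
      qed
      moreover have "b = c"
        using pq(3) p q \<open>i = j\<close> M4(2)[OF i(1)] by (cases b; cases c) (auto simp: h_def)
      ultimately show "p = q" using p q by simp
    qed
    then have inj: "inj_on (\<lambda>p. vs ! h p) ({..<s} \<times> UNIV)"
      using hn(1) vs(1) by (auto simp: inj_on_def nth_eq_iff_index_eq n_def)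
    have "\<not> H_free (with_proj (sP2 s)) (with_proj G \<restriction> T)"
    proof (rule not_H_free_sP2[OF G T inj])
      show "(\<lambda>p. vs ! h p) ` ({..<s} \<times> UNIV) \<subseteq> T" using hn(2) by (auto simp: B_def)
      show "(vs ! h p, vs ! h q) \<in> parcs G \<longleftrightarrow> fst p = fst q \<and> snd p \<noteq> snd q"
        if "p \<in> {..<s} \<times> UNIV" "q \<in> {..<s} \<times> UNIV" for p q
        using hA[OF that] A[OF hn(1)[OF that(1)] hn(1)[OF that(2)]] by simp
    qed
    then show False using free by simp
  qed
  have "accepting (sem (svc_lprog (s - 1)) (init_memory w)) \<longleftrightarrow>
      (\<exists>v u. (\<forall>j<s - 1. v j < L \<and> u j < L) \<and> (\<forall>j\<ge>s - 1. v j = 0 \<and> u j = 0) \<and>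
         good_pairs (s - 1) v u)"
    using sem_all_pairs[OF env, of "s - 1" "s - 1"]
    by (simp add: accepting_def svc_lprog_def zero flip: m_def)
  also have "\<dots> \<longleftrightarrow> (\<exists>S. cover S \<and> card S \<le> k)"
  proof -
    have "n \<le> L" "1 \<le> L" using Leq by auto
    from cover_iff_greedy[where s = s and k = k, OF free' this] show ?thesis
      unfolding good_pairs_def by simp
  qed
  also have "\<dots> \<longleftrightarrow> svc_yes (G, T, k)"
  proof
    assume "\<exists>S. cover S \<and> card S \<le> k"
    then obtain S where S: "cover S" "card S \<le> k" by auto
    have Sn: "S \<subseteq> {..<n}" using S(1) by (simp add: cover_def)
    have "T_vertex_cover G T ((!) vs ` S)"
      unfolding T_vertex_cover_def
    proof (intro conjI ballI)
      show "(!) vs ` S \<subseteq> pverts G" using Sn mem by auto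
      fix e assume e: "e \<in> parcs G"
      obtain a b where ab: "e = (a, b)" by (cases e)
      have "a \<in> set vs" "b \<in> set vs" using e ab vs(2) in_arcsD1 in_arcsD2 by auto
      then obtain x y where xy: "x < n" "y < n" "a = vs ! x" "b = vs ! y"
        by (metis in_set_conv_nth n_def)
      have "x \<in> S \<or> y \<in> S" if "a \<in> T \<or> b \<in> T"
      proof -
        have "A x y" using A[OF xy(1,2)] xy e ab by simp
        moreover have "B x \<or> B y" using that xy by (simp add: B_def)
        ultimately show ?thesis using S(1) xy(1,2) unfolding cover_def by blast
      qed
      then show "case e of (a, b) \<Rightarrow> a \<in> T \<or> b \<in> T \<longrightarrow> a \<in> (!) vs ` S \<or> b \<in> (!) vs ` S"
        using ab xy by auto
    qed
    moreover have "card ((!) vs ` S) \<le> card S"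
      using Sn by (intro card_image_le) (auto intro: finite_subset)
    ultimately show "svc_yes (G, T, k)" using S(2) unfolding svc_yes_def by (auto intro: order_trans)
  next
    assume "svc_yes (G, T, k)"
    then obtain S where S: "T_vertex_cover G T S" "card S \<le> k" unfolding svc_yes_def by auto
    define R where "R = {x. x < n \<and> vs ! x \<in> S}"
    have "S \<subseteq> pverts G" using S(1) by (simp add: T_vertex_cover_def)
    then have "finite S" using pair_finite_verts by (rule finite_subset)
    have "inj_on ((!) vs) R" using vs(1) by (auto simp: inj_on_def R_def nth_eq_iff_index_eq n_def)
    then have "card R \<le> card S"
      using \<open>finite S\<close> by (intro card_inj_on_le) (auto simp: R_def)
    moreover have "cover R"
      unfolding cover_def
    proof (intro conjI allI impI)
      fix x y assume xy: "x < n" "y < n" "A x y" "B x \<or> B y"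
      then have "(vs ! x, vs ! y) \<in> parcs G" "vs ! x \<in> T \<or> vs ! y \<in> T" using A by (auto simp: B_def)
      then show "x \<in> R \<or> y \<in> R" using S(1) xy by (auto simp: T_vertex_cover_def R_def)
    qed (auto simp: R_def)
    ultimately show "\<exists>S. cover S \<and> card S \<le> k" using S(2) by (intro exI[of _ R]) simp
  qed
  finally show ?thesis .
qed

text \<open>After parsing, the only loop bounds are the length of the word and the number of
  vertices, so the length bounds both. Nesting depth depends on \<open>r\<close> alone, so the
  polynomial is the same for all words.\<close>

lemma svc_lprog_time:
  assumes "svc_encodes (G, T, k) w"
  shows "\<exists>t \<le> poly (cost (svc_lprog r)) (length w).
    exec (compile (svc_lprog r)) (init_memory w) t (sem (svc_lprog r) (init_memory w))"
  unfolding svc_lprog_def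
proof (rule exec_compile_Seq)
  obtain vs where w: "w = svc_word vs (G, T, k)" using assms by (auto simp: svc_encodes_def)
  show "counters_ok parse" "bounds parse \<inter> writes parse = {}"
    "\<forall>b\<in>bounds parse. init_memory w b 0 \<le> length w"
    by (simp_all add: parse_def count_vertices_def compute_rows_def read_bound_def init_memory_def)
  have b: "bounds (all_pairs r (test_pairs r)) \<subseteq> {1, 3}"
    using all_pairs_ok(2)[of "test_pairs r" r] by (auto simp: program_defs)
  show "counters_ok (all_pairs r (test_pairs r))" by (rule all_pairs_ok) auto
  show "bounds (all_pairs r (test_pairs r)) \<inter> writes (all_pairs r (test_pairs r)) = {}"
    using b by (auto simp: writes_all_pairs)
  have "sem parse (init_memory w) 1 0 = length w"
    using sem_parse(1)[where a = 1 and vs = vs and G = G and T = T and k = k] by (simp add: w init_memory_def)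
  moreover have "sem parse (init_memory w) 3 0 \<le> length w"
    using sem_parse(2)[where vs = vs and G = G and T = T and k = k] length_svc_word[of vs G T k] by (simp add: w)
  ultimately show "\<forall>b\<in>bounds (all_pairs r (test_pairs r)). sem parse (init_memory w) b 0 \<le> length w"
    using b by auto
qed

theorem theorem11:
  fixes s :: nat
  assumes "s \<ge> 1"
  shows "poly_time_solvable_on svc_encodes svc_yes
           {(G, T, k) \<in> svc_instances. H_free (with_proj (sP2 s)) (with_proj G \<restriction> T)}"
proof -
  have "\<exists>t m. exec (compile (svc_lprog (s - 1))) (init_memory w) t m \<and>
      t \<le> poly (cost (svc_lprog (s - 1))) (length w) \<and> (accepting m \<longleftrightarrow> svc_yes (G, T, k))"
    if "(G, T, k) \<in> svc_instances" "H_free (with_proj (sP2 s)) (with_proj G \<restriction> T)"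
      "svc_encodes (G, T, k) w" for G T k w
    using svc_lprog_time[OF that(3), of "s - 1"] svc_lprog_correct[OF that(3) _ _ that(2)] that(1)
    unfolding svc_instances_def by auto
  then show ?thesis unfolding poly_time_solvable_on_def by blast
qed

end
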